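(* Let $N\ge1$, let $\Omega\subset\mathbb{R}^N$ be an open set, let $1<p<\infty$, and let $0<s<1$. Then the space $C^\infty(\Omega)\cap W^{s+\log,p}(\Omega)$ is dense in $W^{s+\log,p}(\Omega)$ with respect to the norm $\|\cdot\|_{W^{s+\log,p}(\Omega)}$.
   Context: $W^{s+\log,p}(\Omega)$ is the space of real-valued $u\in L^p(\Omega)$ with $$[u]^p_{s+\log,p}:=\iint_{\Omega\times\Omega}|u(x)-u(y)|^p\,\mathbf{k}^{s+\log,+}_p(x-y)\,dx\,dy<\infty,\qquad\mathbf{k}^{s+\log,+}_p(z)=\frac{C(N,s,p)(-\ln|z|)_+}{|z|^{N+sp}},$$ where $(a)_+=\max\{0,a\}$, with norm $\|u\|^p_{W^{s+\log,p}(\Omega)}=\|u\|^p_{L^p(\Omega)}+[u]^p_{s+\log,p}$, and $$C(N,s,p)=\begin{cases}\dfrac{s\,p\,2^{2(s-1)}\,\Gamma\left(\frac{N+sp}{2}\right)}{\pi^{\frac{N-1}{2}}\,\Gamma(1-s)\,\Gamma\left(\frac{p+1}{2}\right)}, & s>\tfrac12,\\[8pt]\dfrac{s\,p\,2^{2s-1}\,\Gamma\left(\frac{N+sp}{2}\right)}{\pi^{\frac N2}\,\Gamma(1-s)}, & s\le\tfrac12.\end{cases}$$ *)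

theory Defs
  imports "HOL-Analysis.Analysis"
begin

text \<open>Only meaningful for open sets, where the Frechet derivative at a point of the set does
  not depend on the values of the function outside the set.\<close>

fun Ck_on :: "nat \<Rightarrow> 'a::euclidean_space set \<Rightarrow> ('a \<Rightarrow> real) \<Rightarrow> bool" where
  "Ck_on 0 \<Omega> f \<longleftrightarrow> continuous_on \<Omega> f"
| "Ck_on (Suc k) \<Omega> f \<longleftrightarrow> (\<forall>x\<in>\<Omega>. f differentiable (at x)) \<and>
     (\<forall>v. Ck_on k \<Omega> (\<lambda>x. frechet_derivative f (at x) v))"

definition C_infinity :: "'a::euclidean_space set \<Rightarrow> ('a \<Rightarrow> real) set" where
  "C_infinity \<Omega> = {f. \<forall>k. Ck_on k \<Omega> f}"

definition C_const :: "nat \<Rightarrow> real \<Rightarrow> real \<Rightarrow> real" where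
  "C_const N s p =
     (if s > 1/2 then
        (s * p * 2 powr (2 * (s - 1)) * Gamma ((real N + s * p) / 2)) /
        (pi powr ((real N - 1) / 2) * Gamma (1 - s) * Gamma ((p + 1) / 2))
      else
        (s * p * 2 powr (2 * s - 1) * Gamma ((real N + s * p) / 2)) /
        (pi powr (real N / 2) * Gamma (1 - s)))"

text \<open>At \<open>z = 0\<close> this evaluates to \<open>0\<close>, which is harmless: the diagonal is a null set and the
  integrand below vanishes there anyway.\<close>

definition slog_kernel :: "real \<Rightarrow> real \<Rightarrow> 'a::euclidean_space \<Rightarrow> real" where
  "slog_kernel s p z =
     C_const DIM('a) s p * max 0 (- ln (norm z)) / norm z powr (real DIM('a) + s * p)"

text \<open>The \<open>p\<close>-th powers of the seminorm and of the \<open>L\<^sup>p\<close> norm, as extended reals.\<close>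

definition slog_seminorm_pow ::
    "'a::euclidean_space set \<Rightarrow> real \<Rightarrow> real \<Rightarrow> ('a \<Rightarrow> real) \<Rightarrow> ennreal" where
  "slog_seminorm_pow \<Omega> s p u =
     (\<integral>\<^sup>+ (x, y). ennreal (\<bar>u x - u y\<bar> powr p * slog_kernel s p (x - y))
        \<partial>(lebesgue_on \<Omega> \<Otimes>\<^sub>M lebesgue_on \<Omega>))"

definition Lp_norm_pow :: "'a::euclidean_space set \<Rightarrow> real \<Rightarrow> ('a \<Rightarrow> real) \<Rightarrow> ennreal" where
  "Lp_norm_pow \<Omega> p u = (\<integral>\<^sup>+ x. ennreal (\<bar>u x\<bar> powr p) \<partial>lebesgue_on \<Omega>)"

definition Lp_space :: "'a::euclidean_space set \<Rightarrow> real \<Rightarrow> ('a \<Rightarrow> real) set" where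
  "Lp_space \<Omega> p = {u \<in> borel_measurable (lebesgue_on \<Omega>). Lp_norm_pow \<Omega> p u < \<infinity>}"

text \<open>As usual, elements are represented by functions rather than by classes of functions that
  agree almost everywhere on \<open>\<Omega>\<close>; values outside \<open>\<Omega>\<close> are irrelevant.\<close>

definition W_slog :: "'a::euclidean_space set \<Rightarrow> real \<Rightarrow> real \<Rightarrow> ('a \<Rightarrow> real) set" where
  "W_slog \<Omega> s p = {u \<in> Lp_space \<Omega> p. slog_seminorm_pow \<Omega> s p u < \<infinity>}"

text \<open>Used for members of \<open>W_slog\<close> only, on which both summands are finite; \<open>W_slog_diff\<close> below
  shows that differences of members are again members.\<close>

definition W_slog_norm :: "'a::euclidean_space set \<Rightarrow> real \<Rightarrow> real \<Rightarrow> ('a \<Rightarrow> real) \<Rightarrow> real" where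
  "W_slog_norm \<Omega> s p u =
     (enn2real (Lp_norm_pow \<Omega> p u) + enn2real (slog_seminorm_pow \<Omega> s p u)) powr (1 / p)"

lemma abs_diff_powr_le:
  fixes a b p :: real
  assumes "0 < p"
  shows "\<bar>a - b\<bar> powr p \<le> 2 powr p * (\<bar>a\<bar> powr p + \<bar>b\<bar> powr p)"
proof -
  have "\<bar>a - b\<bar> powr p \<le> (2 * max \<bar>a\<bar> \<bar>b\<bar>) powr p"
    using assms by (intro powr_mono2) auto
  also have "\<dots> = 2 powr p * max \<bar>a\<bar> \<bar>b\<bar> powr p"
    by (simp add: powr_mult)
  also have "\<dots> \<le> 2 powr p * (\<bar>a\<bar> powr p + \<bar>b\<bar> powr p)"
    by (intro mult_left_mono) (auto simp: max_def)
  finally show ?thesis .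
qed

lemma C_const_nonneg:
  assumes "0 < s" "s < 1" "0 < p"
  shows "0 \<le> C_const N s p"
proof -
  have "0 < Gamma ((real N + s * p) / 2)" "0 < Gamma (1 - s)" "0 < Gamma ((p + 1) / 2)"
    using assms by (auto intro!: Gamma_real_pos add_nonneg_pos)
  then show ?thesis
    using assms unfolding C_const_def by (auto intro!: divide_nonneg_nonneg mult_nonneg_nonneg)
qed

lemma slog_kernel_nonneg:
  assumes "0 < s" "s < 1" "0 < p"
  shows "0 \<le> slog_kernel s p z"
  unfolding slog_kernel_def using C_const_nonneg[OF assms] by simp

lemma W_slog_diff:
  fixes \<Omega> :: "'a::euclidean_space set"
  assumes sp: "0 < s" "s < 1" "0 < p"
    and u: "u \<in> W_slog \<Omega> s p" and v: "v \<in> W_slog \<Omega> s p"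
  shows "(\<lambda>x. u x - v x) \<in> W_slog \<Omega> s p"
proof -
  let ?L = "lebesgue_on \<Omega>"
  let ?c = "ennreal (2 powr p)"
  have um[measurable]: "u \<in> borel_measurable ?L" and vm[measurable]: "v \<in> borel_measurable ?L"
    using u v by (auto simp: W_slog_def Lp_space_def)
  have fin: "Lp_norm_pow \<Omega> p u < \<infinity>" "Lp_norm_pow \<Omega> p v < \<infinity>"
    "slog_seminorm_pow \<Omega> s p u < \<infinity>" "slog_seminorm_pow \<Omega> s p v < \<infinity>"
    using u v by (auto simp: W_slog_def Lp_space_def)
  have idm[measurable]: "(\<lambda>x. x) \<in> ?L \<rightarrow>\<^sub>M borel"
    by (intro measurable_restrict_space1 measurable_completion) simp
  have km[measurable]: "slog_kernel s p \<in> borel_measurable (borel :: 'a measure)"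
    unfolding slog_kernel_def[abs_def] by measurable
  have "Lp_norm_pow \<Omega> p (\<lambda>x. u x - v x)
      \<le> (\<integral>\<^sup>+ x. ?c * (ennreal (\<bar>u x\<bar> powr p) + ennreal (\<bar>v x\<bar> powr p)) \<partial>?L)"
    unfolding Lp_norm_pow_def using abs_diff_powr_le[OF sp(3)]
    by (intro nn_integral_mono) (simp flip: ennreal_plus ennreal_mult)
  also have "\<dots> = ?c * (Lp_norm_pow \<Omega> p u + Lp_norm_pow \<Omega> p v)"
    unfolding Lp_norm_pow_def by (subst nn_integral_cmult) (auto simp: nn_integral_add)
  also have "\<dots> < \<infinity>"
    using fin by (simp add: ennreal_mult_less_top)
  finally have 1: "Lp_norm_pow \<Omega> p (\<lambda>x. u x - v x) < \<infinity>" .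
  have pt: "ennreal (\<bar>(u x - v x) - (u y - v y)\<bar> powr p * slog_kernel s p (x - y))
      \<le> ?c * (ennreal (\<bar>u x - u y\<bar> powr p * slog_kernel s p (x - y))
            + ennreal (\<bar>v x - v y\<bar> powr p * slog_kernel s p (x - y)))" for x y
  proof -
    have "\<bar>(u x - v x) - (u y - v y)\<bar> powr p * slog_kernel s p (x - y)
        \<le> (2 powr p * (\<bar>u x - u y\<bar> powr p + \<bar>v x - v y\<bar> powr p)) * slog_kernel s p (x - y)"
      using abs_diff_powr_le[OF sp(3), of "u x - u y" "v x - v y"]
      by (intro mult_right_mono slog_kernel_nonneg sp) (simp add: algebra_simps)
    then show ?thesis
      using slog_kernel_nonneg[OF sp, of "x - y"]
      by (simp add: algebra_simps flip: ennreal_plus ennreal_mult)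
  qed
  have "slog_seminorm_pow \<Omega> s p (\<lambda>x. u x - v x)
      \<le> (\<integral>\<^sup>+ (x, y). ?c * (ennreal (\<bar>u x - u y\<bar> powr p * slog_kernel s p (x - y))
            + ennreal (\<bar>v x - v y\<bar> powr p * slog_kernel s p (x - y))) \<partial>(?L \<Otimes>\<^sub>M ?L))"
    unfolding slog_seminorm_pow_def using pt by (intro nn_integral_mono) auto
  also have "\<dots> = ?c * (slog_seminorm_pow \<Omega> s p u + slog_seminorm_pow \<Omega> s p v)"
    unfolding slog_seminorm_pow_def case_prod_beta
    by (subst nn_integral_cmult) (auto simp: nn_integral_add)
  also have "\<dots> < \<infinity>"
    using fin by (simp add: ennreal_mult_less_top)
  finally have 2: "slog_seminorm_pow \<Omega> s p (\<lambda>x. u x - v x) < \<infinity>" .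
  from 1 2 show ?thesis
    by (simp add: W_slog_def Lp_space_def)
qed

end

theory Submission
  imports Defs
begin

text \<open>The argument is that of Meyers and Serrin. A function \<open>u\<close> of finite energy on \<open>\<Omega>\<close> is cut into
  countably many pieces \<open>w\<^sub>j\<close>, each supported in a bounded part of \<open>\<Omega>\<close> that keeps a positive distance
  from the complement; every piece is mollified with its own small radius, and the smooth pieces
  are added up again. Since the pieces and their mollifications form locally finite families, the
  sum is smooth on \<open>\<Omega>\<close>, however irregular the boundary may be.

  What has to be checked is that the nonlocal energy, which couples points at a distance, survives
  these operations. Only two properties of the kernel \<open>K\<close> enter: it is measurable, and
  \<open>\<integral> \<bar>z\<bar>\<^sup>p K(z) dz\<close> is finite (locale \<open>nonlocal_kernel\<close>). For the logarithmic kernel the latter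
  holds because \<open>s < 1\<close> leaves a positive power of \<open>\<bar>z\<bar>\<close> that absorbs the logarithm
  (\<open>nonlocal_kernel_slog\<close>).

  Cutting off (\<open>energy_cutoff_finite\<close>): if \<open>\<phi>\<close> is bounded and Lipschitz and vanishes outside \<open>\<Omega>\<close>, then
  the increment of \<open>\<phi> u\<close> between \<open>x\<close> and \<open>y\<close> is controlled by that of \<open>u\<close> plus \<open>\<bar>u\<bar> \<bar>x - y\<bar>\<close>. The
  second contribution is paid for by the moment condition, so \<open>\<phi> u\<close> has finite energy on the whole
  space. Since all smoothness comes from mollification, the cutoffs can be
  built from distance functions (\<open>lipschitz_exhaustion_cutoffs\<close>).

  Mollifying (\<open>energy_convolution_small\<close>): by Jensen's inequality the energy of \<open>w * \<rho> - w\<close> is at most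
  the \<open>\<rho>\<close>-average of the energies of the translation differences \<open>w(\<cdot> - z) - w\<close>. These tend to \<open>0\<close>
  with \<open>z\<close>: writing the double integral over \<open>x\<close> and \<open>h = x - y\<close>, for every fixed \<open>h\<close> the inner
  integral tends to \<open>0\<close> because translations are continuous in \<open>L\<^sup>p\<close>, and dominated convergence in
  \<open>h\<close> does the rest (\<open>energy_translation_tendsto\<close>).

  Summing (\<open>energy_locally_finite_sum_le\<close>): iterating \<open>\<bar>a + b\<bar>\<^sup>p \<le> 2\<^sup>p (\<bar>a\<bar>\<^sup>p + \<bar>b\<bar>\<^sup>p)\<close> costs a factor
  \<open>2\<^bsup>p(j+1)\<^esup>\<close> for the \<open>j\<close>-th error. The factors are known before the radii are chosen, so they do no
  harm.

  Everything is done for Borel functions and iterated integrals over Lebesgue-Borel measure. A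
  Lebesgue measurable \<open>u\<close> is replaced by a Borel function that agrees with it almost everywhere on
  \<open>\<Omega>\<close> and vanishes elsewhere, which does not change the energy (\<open>energy_slog_eq\<close>, \<open>energy_cong_AE\<close>).\<close>

section \<open>Smooth functions\<close>

text \<open>Smoothness is local. This is what makes a locally finite sum of smooth functions smooth, since
  such a sum agrees near each point with a finite one.\<close>

lemma Ck_on_local:
  assumes "\<And>x. x \<in> \<Omega> \<Longrightarrow> \<exists>U g. open U \<and> x \<in> U \<and> Ck_on k U g \<and> (\<forall>y\<in>U. g y = f y)"
  shows "Ck_on k \<Omega> f"
  using assms
proof (induction k arbitrary: f)
  case 0
  have "continuous (at x within \<Omega>) f" if "x \<in> \<Omega>" for x
  proof -
    obtain U g where U: "open U" "x \<in> U" "continuous_on U g" "\<forall>y\<in>U. g y = f y"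
      using 0[OF \<open>x \<in> \<Omega>\<close>] by (elim exE conjE) simp
    then have "continuous_on U f"
      using continuous_on_cong[of U U g f] by simp
    with U have "continuous (at x) f"
      using continuous_on_eq_continuous_at by blast
    then show ?thesis
      using continuous_at_imp_continuous_at_within by blast
  qed
  then show ?case
    by (simp add: continuous_on_eq_continuous_within)
next
  case (Suc k)
  have loc: "\<exists>U g. open U \<and> x \<in> U \<and> Ck_on (Suc k) U g \<and>
      (\<forall>y\<in>U. (g has_derivative frechet_derivative g (at y)) (at y) \<and>
              (f has_derivative frechet_derivative g (at y)) (at y))" if "x \<in> \<Omega>" for x
  proof -
    obtain U g where U: "open U" "x \<in> U" "Ck_on (Suc k) U g" "\<forall>y\<in>U. g y = f y"
      using Suc.prems[OF \<open>x \<in> \<Omega>\<close>] by (elim exE conjE)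
    have g: "(g has_derivative frechet_derivative g (at y)) (at y)" if "y \<in> U" for y
      using U(3) that by (simp add: frechet_derivative_works)
    have "(f has_derivative frechet_derivative g (at y)) (at y)" if "y \<in> U" for y
      by (rule has_derivative_transform_within_open[OF g[OF that] U(1) that]) (use U(4) in auto)
    with g have "\<forall>y\<in>U. (g has_derivative frechet_derivative g (at y)) (at y) \<and>
              (f has_derivative frechet_derivative g (at y)) (at y)" by blast
    with U(1-3) show ?thesis by (intro exI[of _ U] exI[of _ g]) (simp only: simp_thms)
  qed
  have "f differentiable at x" if "x \<in> \<Omega>" for x
    using loc[OF that] unfolding differentiable_def by (elim exE conjE) blast
  moreover have "Ck_on k \<Omega> (\<lambda>x. frechet_derivative f (at x) v)" for v
  proof (rule Suc.IH)
    fix x assume "x \<in> \<Omega>"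
    from loc[OF this] obtain U g where U: "open U" "x \<in> U" "Ck_on (Suc k) U g"
      "\<forall>y\<in>U. (f has_derivative frechet_derivative g (at y)) (at y)"
      by (elim exE conjE) blast
    have "\<forall>y\<in>U. frechet_derivative g (at y) v = frechet_derivative f (at y) v"
    proof
      fix y assume "y \<in> U"
      then have "frechet_derivative g (at y) = frechet_derivative f (at y)"
        using U(4) by (intro frechet_derivative_at) auto
      then show "frechet_derivative g (at y) v = frechet_derivative f (at y) v" by simp
    qed
    with U show "\<exists>U g. open U \<and> x \<in> U \<and> Ck_on k U g
        \<and> (\<forall>y\<in>U. g y = frechet_derivative f (at y) v)"
      by (intro exI[of _ U] exI[of _ "\<lambda>y. frechet_derivative g (at y) v"]) auto
  qed
  ultimately show ?case by simp
qed

lemma Ck_on_subset: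
  assumes "Ck_on k T f" "S \<subseteq> T"
  shows "Ck_on k S f"
  using assms by (induction k arbitrary: f) (auto intro: continuous_on_subset)

text \<open>The practical criterion for smoothness: instead of computing higher derivatives, it suffices to
  exhibit a family of differentiable functions that is stable under directional derivatives. It is
  used below for bump functions, for finite sums and for convolutions.\<close>

lemma C_infinity_UNIV_closed_family:
  assumes "\<And>f x. f \<in> S \<Longrightarrow> f differentiable at x"
    and "\<And>f v. f \<in> S \<Longrightarrow> (\<lambda>x. frechet_derivative f (at x) v) \<in> S"
  shows "S \<subseteq> C_infinity UNIV"
proof -
  have "Ck_on k UNIV f" if "f \<in> S" for k f
    using that
  proof (induction k arbitrary: f)
    case 0
    then have "isCont f x" for x
      using assms(1) by (intro differentiable_imp_continuous_within)
    then show ?case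
      by (simp add: continuous_on_eq_continuous_at)
  next
    case (Suc k)
    then show ?case using assms by simp
  qed
  then show ?thesis by (auto simp: C_infinity_def)
qed

lemma C_infinity_UNIV_D:
  assumes "f \<in> C_infinity UNIV"
  shows "f differentiable at x" "(\<lambda>x. frechet_derivative f (at x) v) \<in> C_infinity UNIV"
    "continuous_on UNIV f"
proof -
  have c: "Ck_on (Suc k) UNIV f" for k
    using assms by (auto simp: C_infinity_def simp del: Ck_on.simps)
  show "f differentiable at x" using c[of 0] by simp
  show "(\<lambda>x. frechet_derivative f (at x) v) \<in> C_infinity UNIV"
    using c by (simp add: C_infinity_def)
  have "Ck_on 0 UNIV f"
    using assms unfolding C_infinity_def by blast
  then show "continuous_on UNIV f" by simp
qed

lemma C_infinity_UNIV_sum: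
  fixes f :: "'b \<Rightarrow> 'a::euclidean_space \<Rightarrow> real"
  assumes "\<And>i. i \<in> I \<Longrightarrow> f i \<in> C_infinity UNIV"
  shows "(\<lambda>x. \<Sum>i\<in>I. f i x) \<in> C_infinity (UNIV :: 'a set)"
proof -
  let ?S = "{\<lambda>x::'a. \<Sum>i\<in>I. g i x | g. \<forall>i\<in>I. g i \<in> C_infinity UNIV}"
  have d: "((\<lambda>x. \<Sum>i\<in>I. g i x) has_derivative (\<lambda>v. \<Sum>i\<in>I. frechet_derivative (g i) (at x) v)) (at x)"
    if "\<forall>i\<in>I. g i \<in> C_infinity UNIV" for x and g :: "'b \<Rightarrow> 'a \<Rightarrow> real"
    using that C_infinity_UNIV_D(1) by (intro has_derivative_sum) (auto simp: frechet_derivative_works)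
  have "?S \<subseteq> C_infinity UNIV"
  proof (rule C_infinity_UNIV_closed_family)
    fix F x v assume "F \<in> ?S"
    then obtain g where F: "F = (\<lambda>x. \<Sum>i\<in>I. g i x)" and g: "\<forall>i\<in>I. g i \<in> C_infinity UNIV"
      by blast
    show "F differentiable at x"
      unfolding F using d[of g x] g by (auto simp: differentiable_def)
    have "(\<lambda>x. frechet_derivative F (at x) v) = (\<lambda>x. \<Sum>i\<in>I. frechet_derivative (g i) (at x) v)"
      unfolding F using g by (intro ext) (simp add: frechet_derivative_at[OF d, symmetric])
    then show "(\<lambda>x. frechet_derivative F (at x) v) \<in> ?S"
      using g C_infinity_UNIV_D(2) by (intro CollectI exI[of _ "\<lambda>i x. frechet_derivative (g i) (at x) v"]) auto
  qed
  then show ?thesis using assms by blast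
qed

text \<open>For \<open>m = 0\<close> this is the classical smooth function that is flat at \<open>0\<close>. The powers in the
  denominator make the family stable under differentiation up to linear combinations.\<close>

definition flat_exp :: "nat \<Rightarrow> real \<Rightarrow> real" where
  "flat_exp m t = (if 0 < t then exp (- (1 / t)) / t ^ m else 0)"

text \<open>The exponential beats every power, in the quantitative form \<open>(1 + x / n)\<^sup>n \<le> exp x\<close> with
  \<open>n = m + 2\<close> and \<open>x = 1 / t\<close>. A quadratic bound is just what makes the derivative at \<open>0\<close> vanish.\<close>

lemma flat_exp_le_square: "\<exists>M. \<forall>t. \<bar>flat_exp m t\<bar> \<le> M * t\<^sup>2"
proof (intro exI allI)
  fix t :: real
  show "\<bar>flat_exp m t\<bar> \<le> real (m + 2) ^ (m + 2) * t\<^sup>2"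
  proof (cases "0 < t")
    case True
    define c :: real where "c = real (m + 2) ^ (m + 2)"
    have c: "0 < c" unfolding c_def by (intro zero_less_power) simp
    have "(1 / t / real (m + 2)) ^ (m + 2) \<le> (1 + 1 / t / real (m + 2)) ^ (m + 2)"
      using True by (intro power_mono) auto
    also have "\<dots> \<le> exp (1 / t)"
    proof (rule exp_ge_one_plus_x_over_n_power_n)
      have "0 \<le> 1 / t" using True by simp
      then show "- real (m + 2) \<le> 1 / t" by linarith
    qed simp
    finally have "(1 / t) ^ (m + 2) / c \<le> exp (1 / t)"
      by (simp only: c_def power_divide)
    then have "1 / (c * t ^ (m + 2)) \<le> exp (1 / t)"
      by (simp add: power_one_over field_simps)
    then have "1 \<le> exp (1 / t) * (c * t ^ (m + 2))"
      using True c by (subst (asm) pos_divide_le_eq) auto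
    also have "\<dots> = (c * t\<^sup>2) * (t ^ m * exp (1 / t))"
      by (simp add: power_add power2_eq_square)
    finally have "1 / (t ^ m * exp (1 / t)) \<le> c * t\<^sup>2"
      using True by (subst pos_divide_le_eq) auto
    then show ?thesis
      unfolding c_def[symmetric] using True by (simp add: flat_exp_def exp_minus divide_simps mult_ac)
  qed (auto simp: flat_exp_def)
qed

lemma flat_exp_deriv:
  "(flat_exp m has_real_derivative flat_exp (m + 2) t - real m * flat_exp (m + 1) t) (at t)"
proof -
  consider "0 < t" | "t < 0" | "t = 0" by linarith
  then show ?thesis
  proof cases
    case 1
    have "((\<lambda>t. exp (- (1 / t)) / t ^ m) has_real_derivative
        flat_exp (m + 2) t - real m * flat_exp (m + 1) t) (at t)"
    proof (cases m)
      case 0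
      then show ?thesis using 1
        by (auto intro!: derivative_eq_intros simp: flat_exp_def field_simps power2_eq_square)
    next
      case (Suc k)
      then show ?thesis using 1
        by (auto intro!: derivative_eq_intros simp: flat_exp_def)
           (simp add: divide_simps power2_eq_square, cases k, simp_all add: algebra_simps)
    qed
    then show ?thesis
      by (rule has_field_derivative_transform_within_open[where S="{0<..}"])
        (use 1 in \<open>auto simp: flat_exp_def\<close>)
  next
    case 2
    have "((\<lambda>t. 0) has_real_derivative flat_exp (m + 2) t - real m * flat_exp (m + 1) t) (at t)"
      using 2 by (simp add: flat_exp_def)
    then show ?thesis
      by (rule has_field_derivative_transform_within_open[where S="{..<0}"])
        (use 2 in \<open>auto simp: flat_exp_def\<close>)
  next
    case 3
    obtain M where M: "\<And>t. \<bar>flat_exp m t\<bar> \<le> M * t\<^sup>2"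
      using flat_exp_le_square[of m] by blast
    have "((\<lambda>h. (flat_exp m (0 + h) - flat_exp m 0) / h) \<longlongrightarrow> 0) (at 0)"
    proof (rule Lim_null_comparison)
      show "\<forall>\<^sub>F h in at 0. norm ((flat_exp m (0 + h) - flat_exp m 0) / h) \<le> M * \<bar>h\<bar>"
      proof (intro eventually_at_topological[THEN iffD2] exI[of _ UNIV] conjI ballI impI)
        fix h :: real assume "h \<noteq> 0"
        then show "norm ((flat_exp m (0 + h) - flat_exp m 0) / h) \<le> M * \<bar>h\<bar>"
          using M[of h] by (simp add: pos_divide_le_eq power2_eq_square mult.assoc flat_exp_def[of m 0])
      qed auto
      show "((\<lambda>h. M * \<bar>h\<bar>) \<longlongrightarrow> (0::real)) (at 0)"
        by (auto intro!: tendsto_eq_intros)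
    qed
    then show ?thesis using 3 by (simp add: DERIV_def flat_exp_def)
  qed
qed

text \<open>The smallest family that contains the radial bumps supported in the ball of radius \<open>r\<close> and is
  visibly stable under directional derivatives: the chain rule for \<open>r\<^sup>2 - \<bar>x\<bar>\<^sup>2\<close> produces linear
  factors \<open>x \<bullet> v\<close>.\<close>

inductive_set bump_family :: "real \<Rightarrow> ('a::euclidean_space \<Rightarrow> real) set" for r where
  base: "(\<lambda>x. flat_exp m (r\<^sup>2 - (norm x)\<^sup>2)) \<in> bump_family r"
| cmult: "f \<in> bump_family r \<Longrightarrow> (\<lambda>x. c * f x) \<in> bump_family r"
| coord: "f \<in> bump_family r \<Longrightarrow> (\<lambda>x. (x \<bullet> v) * f x) \<in> bump_family r"
| add: "f \<in> bump_family r \<Longrightarrow> g \<in> bump_family r \<Longrightarrow> (\<lambda>x. f x + g x) \<in> bump_family r"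

lemma bump_family_derivative:
  assumes "f \<in> bump_family r"
  shows "\<exists>f'. (\<forall>x. (f has_derivative f' x) (at x)) \<and> (\<forall>v. (\<lambda>x. f' x v) \<in> bump_family r)"
  using assms
proof induction
  case (base m)
  let ?t = "\<lambda>x::'a. r\<^sup>2 - (norm x)\<^sup>2"
  let ?h = "\<lambda>x. flat_exp (m + 2) (?t x) - real m * flat_exp (m + 1) (?t x)"
  have "((\<lambda>x. flat_exp m (?t x)) has_derivative (\<lambda>v. (-2 * (x \<bullet> v)) * ?h x)) (at x)" for x
  proof -
    have "(?t has_derivative (\<lambda>v. -2 * (x \<bullet> v))) (at x)"
      unfolding power2_norm_eq_inner
      by (auto intro!: derivative_eq_intros simp: inner_commute)
    then show ?thesis
      by (rule DERIV_compose_FDERIV[OF flat_exp_deriv])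
  qed
  moreover have "(\<lambda>x. (-2 * (x \<bullet> v)) * ?h x) \<in> bump_family r" for v
  proof -
    have "(\<lambda>x. -2 * ((x \<bullet> v) * (flat_exp (m + 2) (?t x) + (- real m) * flat_exp (m + 1) (?t x))))
        \<in> bump_family r"
      by (intro bump_family.intros)
    then show ?thesis by (simp add: mult.assoc)
  qed
  ultimately show ?case
    by (intro exI[of _ "\<lambda>x v. (-2 * (x \<bullet> v)) * ?h x"]) blast
next
  case (cmult f c)
  then obtain f' where f': "\<And>x. (f has_derivative f' x) (at x)" "\<And>v. (\<lambda>x. f' x v) \<in> bump_family r"
    by blast
  then show ?case
    by (intro exI[of _ "\<lambda>x v. c * f' x v"])
      (auto intro!: has_derivative_mult_right bump_family.cmult f')
next
  case (coord f w)
  then obtain f' where f': "\<And>x. (f has_derivative f' x) (at x)" "\<And>v. (\<lambda>x. f' x v) \<in> bump_family r"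
    by blast
  have "((\<lambda>x. (x \<bullet> w) * f x) has_derivative (\<lambda>v. (x \<bullet> w) * f' x v + (v \<bullet> w) * f x)) (at x)" for x
    by (auto intro!: derivative_eq_intros f')
  then show ?case
    using f'(2) coord.hyps
    by (intro exI[of _ "\<lambda>x v. (x \<bullet> w) * f' x v + (v \<bullet> w) * f x"])
      (auto intro!: bump_family.intros)
next
  case (add f g)
  then obtain f' g' where f': "\<And>x. (f has_derivative f' x) (at x)" "\<And>v. (\<lambda>x. f' x v) \<in> bump_family r"
    "\<And>x. (g has_derivative g' x) (at x)" "\<And>v. (\<lambda>x. g' x v) \<in> bump_family r"
    by blast
  then show ?case
    by (intro exI[of _ "\<lambda>x v. f' x v + g' x v"])
      (auto intro!: has_derivative_add bump_family.add f')
qed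

lemma bump_family_C_infinity: "bump_family r \<subseteq> C_infinity UNIV"
proof (rule C_infinity_UNIV_closed_family)
  fix f :: "'a \<Rightarrow> real" and x v assume "f \<in> bump_family r"
  then obtain f' where f': "\<And>x. (f has_derivative f' x) (at x)" "\<And>v. (\<lambda>x. f' x v) \<in> bump_family r"
    using bump_family_derivative by blast
  show "f differentiable at x" using f'(1) differentiable_def by blast
  show "(\<lambda>x. frechet_derivative f (at x) v) \<in> bump_family r"
    using f'(2)[of v] frechet_derivative_at[OF f'(1)] by simp
qed

lemma smooth_mollifier_exists:
  assumes "0 < r"
  obtains \<rho> :: "'a::euclidean_space \<Rightarrow> real" where "\<rho> \<in> C_infinity UNIV" "\<And>x. 0 \<le> \<rho> x"
    "\<And>x. r \<le> norm x \<Longrightarrow> \<rho> x = 0" "integrable lborel \<rho>" "(\<integral>x. \<rho> x \<partial>lborel) = 1"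
proof -
  define g :: "'a \<Rightarrow> real" where "g x = flat_exp 0 (r\<^sup>2 - (norm x)\<^sup>2)" for x
  have g: "g \<in> bump_family r"
    unfolding g_def[abs_def] by (rule bump_family.base)
  then have cont: "continuous_on UNIV g"
    using bump_family_C_infinity C_infinity_UNIV_D(3) by blast
  have nonneg: "0 \<le> g x" for x by (simp add: g_def flat_exp_def)
  have supp: "g x = 0" if "r \<le> norm x" for x
  proof -
    have "r\<^sup>2 \<le> (norm x)\<^sup>2"
      using that assms by (intro power_mono) auto
    then show ?thesis by (simp add: g_def flat_exp_def)
  qed
  have pos: "0 < g x" if "norm x < r" for x
  proof -
    have "(norm x)\<^sup>2 < r\<^sup>2"
      using that by (intro power_strict_mono) auto
    then show ?thesis by (simp add: g_def flat_exp_def)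
  qed
  have int: "integrable lborel g"
  proof -
    have "integrable lborel (\<lambda>x. indicator (cball 0 r) x *\<^sub>R g x)"
      using cont by (intro borel_integrable_compact) (auto intro: continuous_on_subset)
    moreover have "(\<lambda>x. indicator (cball 0 r) x *\<^sub>R g x) = g"
      using supp by (auto simp: fun_eq_iff indicator_def)
    ultimately show ?thesis by simp
  qed
  have "(\<integral>x. g x \<partial>lborel) \<noteq> 0"
  proof
    assume "(\<integral>x. g x \<partial>lborel) = 0"
    then have "AE x in lborel. g x = 0"
      using integral_nonneg_eq_0_iff_AE[OF int] nonneg by simp
    then have "AE x in lborel. x \<notin> ball (0::'a) r"
      by eventually_elim (use pos in force)
    then have "emeasure lborel (ball (0::'a) r) = 0"
      by (subst (asm) AE_iff_measurable[where N="ball 0 r"]) auto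
    then show False
      using assms content_ball_pos[of r "0::'a"] by (simp add: measure_def)
  qed
  then have c: "0 < (\<integral>x. g x \<partial>lborel)"
    using Bochner_Integration.integral_nonneg[of lborel g, OF nonneg] by linarith
  show thesis
  proof (rule that[of "\<lambda>x. (1 / (\<integral>x. g x \<partial>lborel)) * g x"])
    show "(\<lambda>x. (1 / (\<integral>x. g x \<partial>lborel)) * g x) \<in> C_infinity UNIV"
      using bump_family.cmult[OF g] bump_family_C_infinity by blast
  qed (use c nonneg supp int in auto)
qed

section \<open>Mollification of integrable functions\<close>

text \<open>Vanishing is required only where \<open>r < norm x\<close>, an open condition, so that directional derivatives
  belong to the same set.\<close>

definition test_functions :: "real \<Rightarrow> ('a::euclidean_space \<Rightarrow> real) set" where
  "test_functions r = {g \<in> C_infinity UNIV. \<forall>x. r < norm x \<longrightarrow> g x = 0}"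

lemma test_functions_has_derivative:
  assumes "g \<in> test_functions r"
  shows "(g has_derivative frechet_derivative g (at x)) (at x)"
  using assms C_infinity_UNIV_D(1)[of g x] by (simp add: test_functions_def frechet_derivative_works)

lemma test_functions_derivative:
  assumes g: "g \<in> test_functions r"
  shows "(\<lambda>x. frechet_derivative g (at x) v) \<in> test_functions r"
proof -
  have "frechet_derivative g (at x) v = 0" if "r < norm x" for x
  proof -
    \<comment> \<open>Near such a point the function is identically zero.\<close>
    have "open {y::'a. r < norm y}" by (intro open_Collect_less continuous_intros)
    then have "(g has_derivative (\<lambda>v. 0)) (at x)"
      using that g
      by (intro has_derivative_transform_within_open[of "\<lambda>x. 0" _ _ _ "{y. r < norm y}" g])
        (auto simp: test_functions_def)
    from frechet_derivative_at[OF this] show ?thesis by metis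
  qed
  then show ?thesis
    using g C_infinity_UNIV_D(2)[of g v] by (simp add: test_functions_def)
qed

lemma test_functions_measurable:
  assumes "g \<in> test_functions r"
  shows "g \<in> borel_measurable borel"
  using assms C_infinity_UNIV_D(3)[of g]
  by (auto simp: test_functions_def intro: borel_measurable_continuous_onI)

lemma test_functions_bounded:
  assumes g: "g \<in> test_functions r"
  obtains B where "0 \<le> B" "\<And>x. \<bar>g x\<bar> \<le> B"
proof -
  have "compact (g ` cball 0 r)"
    using g C_infinity_UNIV_D(3)[of g]
    by (intro compact_continuous_image) (auto simp: test_functions_def intro: continuous_on_subset)
  then have "bounded (g ` cball 0 r)" by (rule compact_imp_bounded)
  then obtain B where "\<forall>y\<in>g ` cball 0 r. norm y \<le> B" unfolding bounded_iff by blast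
  then have B: "\<bar>g x\<bar> \<le> B" if "x \<in> cball 0 r" for x
    using that by auto
  have "\<bar>g x\<bar> \<le> max 0 B" for x
    using g B[of x] by (cases "r < norm x") (auto simp: test_functions_def)
  then show thesis using that[of "max 0 B"] by auto
qed

lemma linear_real_bound:
  fixes F :: "'a::euclidean_space \<Rightarrow> real"
  assumes "linear F" "\<And>b. b \<in> Basis \<Longrightarrow> \<bar>F b\<bar> \<le> B b"
  shows "\<bar>F v\<bar> \<le> (\<Sum>b\<in>Basis. B b) * norm v"
proof -
  have "F v = F (\<Sum>b\<in>Basis. (v \<bullet> b) *\<^sub>R b)" by (simp add: euclidean_representation)
  also have "\<dots> = (\<Sum>b\<in>Basis. (v \<bullet> b) * F b)"
    using assms(1) by (simp add: linear_sum linear_cmul)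
  also have "\<bar>\<dots>\<bar> \<le> (\<Sum>b\<in>Basis. norm v * B b)"
    using assms(2)
    by (intro order_trans[OF sum_abs] sum_mono) (auto simp: abs_mult Basis_le_norm intro!: mult_mono)
  finally show ?thesis by (simp add: sum_distrib_left mult.commute)
qed

lemma test_functions_derivative_bounded:
  assumes g: "g \<in> test_functions r"
  obtains B where "0 \<le> B" "\<And>x v. \<bar>frechet_derivative g (at x) v\<bar> \<le> B * norm v"
proof -
  have "\<exists>B\<ge>0. \<forall>x. \<bar>frechet_derivative g (at x) b\<bar> \<le> B" for b
    using test_functions_bounded[OF test_functions_derivative[OF g]] by metis
  then obtain B where B: "\<And>b. 0 \<le> B b" "\<And>b x. \<bar>frechet_derivative g (at x) b\<bar> \<le> B b"
    by metis
  show thesis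
  proof (rule that)
    show "0 \<le> (\<Sum>b\<in>Basis. B b)" using B(1) by (intro sum_nonneg) auto
    show "\<bar>frechet_derivative g (at x) v\<bar> \<le> (\<Sum>b\<in>Basis. B b) * norm v" for x v
      using B(2) has_derivative_linear[OF test_functions_has_derivative[OF g]]
      by (intro linear_real_bound) auto
  qed
qed

lemma test_functions_lipschitz:
  assumes g: "g \<in> test_functions r"
  obtains L where "0 \<le> L" "\<And>x y. \<bar>g x - g y\<bar> \<le> L * norm (x - y)"
proof -
  obtain B where B: "0 \<le> B" "\<And>x v. \<bar>frechet_derivative g (at x) v\<bar> \<le> B * norm v"
    using test_functions_derivative_bounded[OF g] by blast
  have "norm (g x - g y) \<le> B * norm (x - y)" for x y
    by (rule differentiable_bound[of UNIV g "\<lambda>x. frechet_derivative g (at x)"])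
      (use B test_functions_has_derivative[OF g] in \<open>auto intro!: onorm_bound\<close>)
  then show thesis using that B(1) by auto
qed

text \<open>A second-order Taylor estimate, uniform in the base point because all second derivatives are
  bounded. The uniformity allows the estimate to be integrated against any integrable function.\<close>

lemma test_functions_taylor:
  assumes g: "g \<in> test_functions r"
  obtains C where "0 \<le> C"
    "\<And>x v. \<bar>g (x + v) - g x - frechet_derivative g (at x) v\<bar> \<le> C * (norm v)\<^sup>2"
proof -
  let ?D = "\<lambda>x v. frechet_derivative g (at x) v"
  have lin: "linear (?D x)" for x
    using has_derivative_linear[OF test_functions_has_derivative[OF g]] .
  have "\<exists>L\<ge>0. \<forall>x y. \<bar>?D x b - ?D y b\<bar> \<le> L * norm (x - y)" for b
    using test_functions_lipschitz[OF test_functions_derivative[OF g]] by metis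
  then obtain L where L: "\<And>b. 0 \<le> L b" "\<And>b x y. \<bar>?D x b - ?D y b\<bar> \<le> L b * norm (x - y)"
    by metis
  define C where "C = (\<Sum>b\<in>Basis. L b)"
  have "0 \<le> C" using L(1) by (simp add: C_def sum_nonneg)
  have DL: "\<bar>?D x v - ?D y v\<bar> \<le> C * norm (x - y) * norm v" for x y v
  proof -
    have "\<bar>?D x v - ?D y v\<bar> \<le> (\<Sum>b\<in>Basis. L b * norm (x - y)) * norm v"
      by (rule linear_real_bound[of "\<lambda>v. ?D x v - ?D y v"]) (auto intro!: linear_compose_sub lin L)
    then show ?thesis by (simp add: C_def sum_distrib_right)
  qed
  \<comment> \<open>Subtracting the linear map \<open>?D x\<close> turns the remainder into an increment of a function whose derivative is small on the ball.\<close>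
  have "norm ((g (x + v) - ?D x (x + v)) - (g x - ?D x x)) \<le> (C * norm v) * norm ((x + v) - x)" for x v
  proof (rule differentiable_bound[of "cball x (norm v)" "\<lambda>z. g z - ?D x z" "\<lambda>z h. ?D z h - ?D x h"])
    fix z assume z: "z \<in> cball x (norm v)"
    have "bounded_linear (?D x)"
      using has_derivative_bounded_linear[OF test_functions_has_derivative[OF g]] .
    then show "((\<lambda>z. g z - ?D x z) has_derivative (\<lambda>h. ?D z h - ?D x h)) (at z within cball x (norm v))"
      by (intro has_derivative_diff bounded_linear_imp_has_derivative
          has_derivative_at_withinI[OF test_functions_has_derivative[OF g]])
    have "\<bar>?D z h - ?D x h\<bar> \<le> C * norm v * norm h" for h
    proof -
      have "C * norm (z - x) * norm h \<le> C * norm v * norm h"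
        using z \<open>0 \<le> C\<close> by (intro mult_right_mono mult_left_mono) (auto simp: dist_norm norm_minus_commute)
      with DL[of z h x] show ?thesis by linarith
    qed
    then show "onorm (\<lambda>h. ?D z h - ?D x h) \<le> C * norm v"
      using \<open>0 \<le> C\<close> by (intro onorm_bound) auto
  qed (auto simp: dist_norm)
  moreover have "?D x (x + v) = ?D x x + ?D x v" for x v
    by (rule linear_add[OF lin])
  moreover have "(a - (b + c)) - (d - b) = a - d - c" for a b c d :: real
    by simp
  ultimately have "\<bar>g (x + v) - g x - ?D x v\<bar> \<le> C * (norm v)\<^sup>2" for x v
    by (simp add: power2_eq_square mult.assoc)
  with \<open>0 \<le> C\<close> show thesis using that by blast
qed

definition convolution :: "('a::euclidean_space \<Rightarrow> real) \<Rightarrow> ('a \<Rightarrow> real) \<Rightarrow> 'a \<Rightarrow> real" where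
  "convolution w g x = (\<integral>y. w y * g (x - y) \<partial>lborel)"

lemma convolution_integrable:
  fixes w :: "'a::euclidean_space \<Rightarrow> real"
  assumes w: "integrable lborel w" and g: "g \<in> test_functions r"
  shows "integrable lborel (\<lambda>y. w y * g (x - y))"
proof -
  obtain B where B: "0 \<le> B" "\<And>x. \<bar>g x\<bar> \<le> B" using test_functions_bounded[OF g] by blast
  note [measurable] = test_functions_measurable[OF g] borel_measurable_integrable[OF w]
  have "integrable lborel (\<lambda>y. B * w y)" using w by simp
  then show ?thesis
  proof (rule Bochner_Integration.integrable_bound)
    show "AE y in lborel. norm (w y * g (x - y)) \<le> norm (B * w y)"
      using B by (intro AE_I2) (auto simp: abs_mult mult.commute[of B] intro!: mult_left_mono order_trans[OF B(2)])
  qed measurable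
qed

lemma convolution_bound:
  fixes w :: "'a::euclidean_space \<Rightarrow> real"
  assumes w: "integrable lborel w" and "integrable lborel (\<lambda>y. w y * k y)" "\<And>y. \<bar>k y\<bar> \<le> B"
  shows "\<bar>\<integral>y. w y * k y \<partial>lborel\<bar> \<le> B * (\<integral>y. \<bar>w y\<bar> \<partial>lborel)"
proof -
  have "\<bar>\<integral>y. w y * k y \<partial>lborel\<bar> \<le> (\<integral>y. \<bar>w y * k y\<bar> \<partial>lborel)"
    using integral_norm_bound[of lborel "\<lambda>y. w y * k y"] by simp
  also have "\<dots> \<le> (\<integral>y. B * \<bar>w y\<bar> \<partial>lborel)"
    using assms integrable_abs[OF assms(2)] by (intro integral_mono) (auto simp: abs_mult mult.commute[of B] intro!: mult_left_mono)
  finally show ?thesis by simp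
qed

text \<open>Differentiation under the integral sign. The Taylor remainder of \<open>g\<close> is at most \<open>C \<bar>v\<bar>\<^sup>2\<close>
  uniformly, so after integration it is at most \<open>C \<bar>v\<bar>\<^sup>2\<close> times the \<open>L\<^sup>1\<close> norm of \<open>w\<close>.\<close>

lemma convolution_has_derivative:
  fixes w :: "'a::euclidean_space \<Rightarrow> real"
  assumes w: "integrable lborel w" and g: "g \<in> test_functions r"
  shows "(convolution w g has_derivative
    (\<lambda>v. convolution w (\<lambda>z. frechet_derivative g (at z) v) x)) (at x)"
proof -
  let ?D = "\<lambda>x v. frechet_derivative g (at x) v"
  let ?W = "\<integral>y. \<bar>w y\<bar> \<partial>lborel"
  have lin: "linear (?D x)" for x
    using has_derivative_linear[OF test_functions_has_derivative[OF g]] .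
  note int = convolution_integrable[OF w g] convolution_integrable[OF w test_functions_derivative[OF g]]
  obtain B where B: "0 \<le> B" "\<And>x v. \<bar>?D x v\<bar> \<le> B * norm v"
    using test_functions_derivative_bounded[OF g] by blast
  obtain C where C: "0 \<le> C" "\<And>x v. \<bar>g (x + v) - g x - ?D x v\<bar> \<le> C * (norm v)\<^sup>2"
    using test_functions_taylor[OF g] by blast
  have bl: "bounded_linear (\<lambda>v. convolution w (\<lambda>z. ?D z v) x)"
  proof (rule bounded_linear_intro)
    show "convolution w (\<lambda>z. ?D z (a + b)) x
        = convolution w (\<lambda>z. ?D z a) x + convolution w (\<lambda>z. ?D z b) x" for a b
      unfolding convolution_def
      by (subst Bochner_Integration.integral_add[symmetric])
        (auto intro!: int simp: linear_add[OF lin] algebra_simps)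
    show "convolution w (\<lambda>z. ?D z (c *\<^sub>R a)) x = c *\<^sub>R convolution w (\<lambda>z. ?D z a) x" for c a
      unfolding convolution_def by (simp add: linear_cmul[OF lin] mult.left_commute)
    show "norm (convolution w (\<lambda>z. ?D z a) x) \<le> norm a * (B * ?W)" for a
      unfolding convolution_def
      using convolution_bound[OF w int(2)[of x a] B(2)] by (simp add: mult_ac)
  qed
  have est: "\<bar>convolution w g (x + v) - convolution w g x - convolution w (\<lambda>z. ?D z v) x\<bar>
      \<le> C * (norm v)\<^sup>2 * ?W" for v
  proof -
    let ?k = "\<lambda>y. g ((x - y) + v) - g (x - y) - ?D (x - y) v"
    have i: "integrable lborel (\<lambda>y. w y * ?k y)"
      using Bochner_Integration.integrable_diff[OF Bochner_Integration.integrable_diff[OF int(1)[of "x + v"] int(1)[of x]] int(2)[of x v]]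
      by (simp add: algebra_simps)
    have "convolution w g (x + v) - convolution w g x - convolution w (\<lambda>z. ?D z v) x
        = (\<integral>y. w y * g (x + v - y) - w y * g (x - y) - w y * ?D (x - y) v \<partial>lborel)"
      unfolding convolution_def
      by (simp add: Bochner_Integration.integral_diff Bochner_Integration.integrable_diff int)
    also have "\<dots> = (\<integral>y. w y * ?k y \<partial>lborel)"
      by (simp add: algebra_simps)
    finally show ?thesis
      using convolution_bound[OF w i C(2)] by simp
  qed
  have "(\<lambda>v. norm (convolution w g (x + v) - convolution w g x - convolution w (\<lambda>z. ?D z v) x) / norm v)
      \<midarrow>0\<rightarrow> 0"
  proof (rule Lim_null_comparison)
    show "\<forall>\<^sub>F v in at 0. norm (norm (convolution w g (x + v) - convolution w g x
        - convolution w (\<lambda>z. ?D z v) x) / norm v) \<le> C * ?W * norm v"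
    proof (intro eventually_at_topological[THEN iffD2] exI[of _ UNIV] conjI ballI impI)
      fix v :: 'a assume "v \<noteq> 0"
      then show "norm (norm (convolution w g (x + v) - convolution w g x
        - convolution w (\<lambda>z. ?D z v) x) / norm v) \<le> C * ?W * norm v"
        using est[of v] by (simp add: pos_divide_le_eq power2_eq_square mult_ac)
    qed auto
    show "((\<lambda>v. C * ?W * norm v) \<longlongrightarrow> 0) (at 0)"
      by (auto intro!: tendsto_eq_intros)
  qed
  with bl show ?thesis by (simp add: has_derivative_at)
qed

text \<open>The convolutions of \<open>w\<close> with test functions form a family stable under directional derivatives,
  because the derivative falls on the test function.\<close>

lemma convolution_smooth:
  fixes w :: "'a::euclidean_space \<Rightarrow> real"
  assumes w: "integrable lborel w" and g: "g \<in> test_functions r"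
  shows "convolution w g \<in> C_infinity UNIV"
proof -
  have "convolution w ` test_functions r \<subseteq> C_infinity UNIV"
  proof (rule C_infinity_UNIV_closed_family)
    fix f x v assume "f \<in> convolution w ` test_functions r"
    then obtain g where f: "f = convolution w g" and g: "g \<in> test_functions r" by blast
    note d = convolution_has_derivative[OF w g]
    show "f differentiable at x" unfolding f using d by (auto simp: differentiable_def)
    have "(\<lambda>x. frechet_derivative f (at x) v) = convolution w (\<lambda>z. frechet_derivative g (at z) v)"
      unfolding f by (intro ext) (simp add: frechet_derivative_at[OF d, symmetric])
    then show "(\<lambda>x. frechet_derivative f (at x) v) \<in> convolution w ` test_functions r"
      using test_functions_derivative[OF g] by blast
  qed
  then show ?thesis using g by blast
qed

section \<open>Continuity of translations in \<open>L\<^sup>p\<close>\<close>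

lemma nn_integral_lborel_translate:
  fixes F :: "'a::euclidean_space \<Rightarrow> ennreal"
  assumes [measurable]: "F \<in> borel_measurable borel"
  shows "(\<integral>\<^sup>+x. F (x + t) \<partial>lborel) = (\<integral>\<^sup>+x. F x \<partial>lborel)"
proof -
  have "(\<integral>\<^sup>+x. F x \<partial>lborel) = (\<integral>\<^sup>+x. F x \<partial>distr lborel borel ((+) t))"
    by (simp add: lborel_distr_plus)
  also have "\<dots> = (\<integral>\<^sup>+x. F (x + t) \<partial>lborel)"
    by (subst nn_integral_distr) (auto simp: add.commute)
  finally show ?thesis by simp
qed

lemma lborel_distr_reflect:
  fixes t :: "'a::euclidean_space"
  shows "distr lborel borel (\<lambda>x. t - x) = lborel"
  using lborel_affine[of "-1" t] by (simp add: density_1)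

lemma nn_integral_lborel_reflect:
  fixes F :: "'a::euclidean_space \<Rightarrow> ennreal"
  assumes [measurable]: "F \<in> borel_measurable borel"
  shows "(\<integral>\<^sup>+x. F (t - x) \<partial>lborel) = (\<integral>\<^sup>+x. F x \<partial>lborel)"
proof -
  have "(\<integral>\<^sup>+x. F x \<partial>lborel) = (\<integral>\<^sup>+x. F x \<partial>distr lborel borel (\<lambda>x. t - x))"
    by (simp add: lborel_distr_reflect)
  also have "\<dots> = (\<integral>\<^sup>+x. F (t - x) \<partial>lborel)"
    by (subst nn_integral_distr) auto
  finally show ?thesis by simp
qed

lemma convolution_commute:
  fixes w :: "'a::euclidean_space \<Rightarrow> real"
  assumes [measurable]: "w \<in> borel_measurable borel" "g \<in> borel_measurable borel"
  shows "convolution w g x = (\<integral>z. g z * w (x - z) \<partial>lborel)"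
proof -
  have "convolution w g x = (\<integral>y. w y * g (x - y) \<partial>distr lborel borel (\<lambda>z. x - z))"
    unfolding convolution_def by (simp add: lborel_distr_reflect)
  also have "\<dots> = (\<integral>z. w (x - z) * g (x - (x - z)) \<partial>lborel)"
    by (subst integral_distr) auto
  finally show ?thesis by (simp add: mult.commute)
qed

lemma integrable_convolution_commute:
  fixes w :: "'a::euclidean_space \<Rightarrow> real"
  assumes [measurable]: "w \<in> borel_measurable borel" "g \<in> borel_measurable borel"
    and "integrable lborel (\<lambda>y. w y * g (x - y))"
  shows "integrable lborel (\<lambda>z. g z * w (x - z))"
proof -
  have "integrable (distr lborel borel (\<lambda>z. x - z)) (\<lambda>y. w y * g (x - y))"
    using assms by (simp add: lborel_distr_reflect)
  then have "integrable lborel (\<lambda>z. w (x - z) * g (x - (x - z)))"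
    by (subst (asm) integrable_distr_eq) auto
  then show ?thesis by (simp add: mult.commute)
qed

lemma ennreal_abs_diff_powr_le:
  fixes a b p :: real
  assumes "0 < p"
  shows "ennreal (\<bar>a - b\<bar> powr p) \<le> ennreal (2 powr p) * (ennreal (\<bar>a\<bar> powr p) + ennreal (\<bar>b\<bar> powr p))"
  using abs_diff_powr_le[OF assms, of a b] by (simp flip: ennreal_plus ennreal_mult)

lemma nn_integral_abs_diff_powr_le:
  fixes f g :: "'a \<Rightarrow> real"
  assumes "0 < p" and [measurable]: "f \<in> borel_measurable M" "g \<in> borel_measurable M"
  shows "(\<integral>\<^sup>+x. ennreal (\<bar>f x - g x\<bar> powr p) \<partial>M)
    \<le> ennreal (2 powr p) * ((\<integral>\<^sup>+x. ennreal (\<bar>f x\<bar> powr p) \<partial>M) + (\<integral>\<^sup>+x. ennreal (\<bar>g x\<bar> powr p) \<partial>M))"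
proof -
  have "(\<integral>\<^sup>+x. ennreal (\<bar>f x - g x\<bar> powr p) \<partial>M)
    \<le> (\<integral>\<^sup>+x. ennreal (2 powr p) * (ennreal (\<bar>f x\<bar> powr p) + ennreal (\<bar>g x\<bar> powr p)) \<partial>M)"
    by (intro nn_integral_mono ennreal_abs_diff_powr_le assms)
  also have "\<dots> = ennreal (2 powr p) * ((\<integral>\<^sup>+x. ennreal (\<bar>f x\<bar> powr p) \<partial>M) + (\<integral>\<^sup>+x. ennreal (\<bar>g x\<bar> powr p) \<partial>M))"
    by (simp add: nn_integral_cmult nn_integral_add)
  finally show ?thesis .
qed

lemma nn_integral_powr_tendsto_0:
  fixes f :: "nat \<Rightarrow> 'a \<Rightarrow> real"
  assumes p: "0 < p" and [measurable]: "\<And>n. f n \<in> borel_measurable M" "g \<in> borel_measurable M"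
    and le: "\<And>n. AE x in M. \<bar>f n x\<bar> \<le> g x" and g: "(\<integral>\<^sup>+x. ennreal (g x powr p) \<partial>M) < \<infinity>"
    and lim: "AE x in M. (\<lambda>n. f n x) \<longlonglongrightarrow> 0"
  shows "(\<lambda>n. \<integral>\<^sup>+x. ennreal (\<bar>f n x\<bar> powr p) \<partial>M) \<longlonglongrightarrow> 0"
proof -
  have "(\<lambda>n. \<integral>\<^sup>+x. ennreal (\<bar>f n x\<bar> powr p) \<partial>M) \<longlonglongrightarrow> (\<integral>\<^sup>+x. 0 \<partial>M)"
  proof (rule nn_integral_dominated_convergence[where w = "\<lambda>x. ennreal (g x powr p)"])
    show "AE x in M. ennreal (\<bar>f n x\<bar> powr p) \<le> ennreal (g x powr p)" for n
      using le[of n] by eventually_elim (use p in \<open>auto intro!: ennreal_leI powr_mono2\<close>)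
    show "AE x in M. (\<lambda>n. ennreal (\<bar>f n x\<bar> powr p)) \<longlonglongrightarrow> 0"
      using lim
    proof eventually_elim
      case (elim x)
      then have "(\<lambda>n. \<bar>f n x\<bar> powr p) \<longlonglongrightarrow> 0 powr p"
        using p by (intro tendsto_powr' tendsto_rabs_zero tendsto_const) auto
      then have "(\<lambda>n. ennreal (\<bar>f n x\<bar> powr p)) \<longlonglongrightarrow> ennreal (0 powr p)"
        by (rule tendsto_ennrealI)
      then show ?case by simp
    qed
  qed (use g in auto)
  then show ?thesis by simp
qed

lemma tendsto_ennreal_0_obtain:
  assumes "a \<longlonglongrightarrow> (0::ennreal)" "0 < (e::ennreal)"
  obtains n :: nat where "a n < e"
proof -
  have "\<forall>\<^sub>F n in sequentially. a n < e" using order_tendstoD(2)[OF assms] .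
  then show thesis using that eventually_sequentially by auto
qed

lemma nn_integral_bounded_on_cball_finite:
  fixes R c p :: real
  shows "(\<integral>\<^sup>+x. ennreal ((c * indicator (cball (0::'a::euclidean_space) R) x) powr p) \<partial>lborel) < \<infinity>"
proof -
  have "(\<integral>\<^sup>+x. ennreal ((c * indicator (cball (0::'a) R) x) powr p) \<partial>lborel)
     \<le> (\<integral>\<^sup>+x. ennreal (c powr p) * indicator (cball (0::'a) R) x \<partial>lborel)"
    by (intro nn_integral_mono) (auto simp: indicator_def)
  also have "\<dots> = ennreal (c powr p) * emeasure lborel (cball (0::'a) R)"
    by (subst nn_integral_cmult_indicator) auto
  also have "\<dots> < \<infinity>"
    using emeasure_lborel_cball_finite[of "0::'a" R] by (simp add: ennreal_mult_less_top)
  finally show ?thesis .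
qed

lemma Lp_truncation:
  fixes f :: "'a::euclidean_space \<Rightarrow> real"
  assumes p: "0 < p" and [measurable]: "f \<in> borel_measurable borel"
    and fin: "(\<integral>\<^sup>+x. ennreal (\<bar>f x\<bar> powr p) \<partial>lborel) < \<infinity>" and e: "0 < e"
  obtains M :: real and g where "0 \<le> M" "g \<in> borel_measurable borel" "\<And>x. \<bar>g x\<bar> \<le> M * indicator (cball 0 M) x"
    "(\<integral>\<^sup>+x. ennreal (\<bar>f x - g x\<bar> powr p) \<partial>lborel) < e"
proof -
  define F where "F n x = max (- real n) (min (real n) (f x)) * indicator (cball 0 (real n)) x" for n x
  have [measurable]: "F n \<in> borel_measurable borel" for n
    unfolding F_def by (intro borel_measurable_times borel_measurable_indicator
        borel_measurable_max borel_measurable_min borel_measurable_const assms) auto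
  have "(\<lambda>n. \<integral>\<^sup>+x. ennreal (\<bar>f x - F n x\<bar> powr p) \<partial>lborel) \<longlonglongrightarrow> 0"
  proof (rule nn_integral_powr_tendsto_0[where g = "\<lambda>x. \<bar>f x\<bar>"])
    show "AE x in lborel. \<bar>f x - F n x\<bar> \<le> \<bar>f x\<bar>" for n
      by (intro AE_I2) (auto simp: F_def indicator_def)
    show "AE x in lborel. (\<lambda>n. f x - F n x) \<longlonglongrightarrow> 0"
    proof (intro AE_I2 tendsto_eventually)
      fix x :: 'a
      obtain N where N: "\<bar>f x\<bar> + norm x \<le> real N" using real_arch_simple by blast
      show "\<forall>\<^sub>F n in sequentially. f x - F n x = 0"
        using eventually_ge_at_top[of N]
      proof eventually_elim
        case (elim n)
        then have "real N \<le> real n" by simp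
        with N have "\<bar>f x\<bar> \<le> real n" "norm x \<le> real n"
          using norm_ge_zero[of x] by linarith+
        then show ?case by (auto simp: F_def)
      qed
    qed
  qed (use p fin in auto)
  from tendsto_ennreal_0_obtain[OF this e] obtain n
    where "(\<integral>\<^sup>+x. ennreal (\<bar>f x - F n x\<bar> powr p) \<partial>lborel) < e" .
  then show thesis
    by (intro that[of "real n" "F n"]) (auto simp: F_def indicator_def)
qed

text \<open>Density of compactly supported continuous functions in \<open>L\<^sup>p\<close>. After truncation, both in height
  and in space, a measurable function is an almost everywhere limit of continuous functions; these
  are clipped to the same height and multiplied by a continuous spatial cutoff, so that dominated
  convergence applies.\<close>

lemma Lp_approx_continuous:
  fixes f :: "'a::euclidean_space \<Rightarrow> real"
  assumes p: "0 < p" and [measurable]: "f \<in> borel_measurable borel"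
    and fin: "(\<integral>\<^sup>+x. ennreal (\<bar>f x\<bar> powr p) \<partial>lborel) < \<infinity>" and e: "0 < (e::real)"
  obtains h :: "'a \<Rightarrow> real" and M where "continuous_on UNIV h" "\<And>x. \<bar>h x\<bar> \<le> M * indicator (cball 0 M) x"
    "(\<integral>\<^sup>+x. ennreal (\<bar>f x - h x\<bar> powr p) \<partial>lborel) \<le> ennreal e"
proof -
  define e' where "e' = e / (2 * 2 powr p)"
  have e': "0 < ennreal e'" using e by (simp add: e'_def)
  obtain M g where M: "0 \<le> M" and [measurable]: "g \<in> borel_measurable borel"
    and g: "\<And>x. \<bar>g x\<bar> \<le> M * indicator (cball 0 M) x"
      "(\<integral>\<^sup>+x. ennreal (\<bar>f x - g x\<bar> powr p) \<partial>lborel) < ennreal e'"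
    using Lp_truncation[OF p assms(2) fin e'] by blast
  have "g measurable_on UNIV"
    by (intro lebesgue_measurable_imp_measurable_on measurable_completion) auto
  then obtain N G where N: "negligible N" and G: "\<And>n. continuous_on UNIV (G n)"
    and lim: "\<And>x. x \<notin> N \<Longrightarrow> (\<lambda>n. G n x) \<longlonglongrightarrow> g x"
    unfolding measurable_on_def by auto
  define H where "H n x = max (- M) (min M (G n x)) * max 0 (min 1 (M + 1 - norm x))" for n x
  have contH: "continuous_on UNIV (H n)" for n
    unfolding H_def by (intro continuous_intros G)
  then have [measurable]: "H n \<in> borel_measurable borel" for n
    by (intro borel_measurable_continuous_onI)
  have H_le: "\<bar>H n x\<bar> \<le> M * indicator (cball 0 (M + 1)) x" for n x
  proof -
    have "\<bar>max (- M) (min M (G n x))\<bar> \<le> M" "\<bar>max 0 (min 1 (M + 1 - norm x))\<bar> \<le> indicator (cball 0 (M + 1)) x"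
      using M by (auto simp: indicator_def)
    then show ?thesis unfolding H_def abs_mult using M by (intro mult_mono) auto
  qed
  have "(\<lambda>n. \<integral>\<^sup>+x. ennreal (\<bar>g x - H n x\<bar> powr p) \<partial>lborel) \<longlonglongrightarrow> 0"
  proof (rule nn_integral_powr_tendsto_0[where g = "\<lambda>x. 2 * M * indicator (cball 0 (M + 1)) x"])
    show "AE x in lborel. \<bar>g x - H n x\<bar> \<le> 2 * M * indicator (cball 0 (M + 1)) x" for n
    proof (intro AE_I2)
      fix x :: 'a
      have "indicator (cball 0 M) x \<le> (indicator (cball 0 (M + 1)) x :: real)" by (simp add: indicator_def)
      then have "\<bar>g x\<bar> \<le> M * indicator (cball 0 (M + 1)) x"
        using g(1)[of x] M mult_left_mono order_trans by blast
      with H_le[of n x] show "\<bar>g x - H n x\<bar> \<le> 2 * M * indicator (cball 0 (M + 1)) x" by linarith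
    qed
    have "AE x in lebesgue. x \<notin> N"
      using N by (simp add: AE_not_in negligible_iff_null_sets)
    then have "AE x in lebesgue. (\<lambda>n. g x - H n x) \<longlonglongrightarrow> 0"
    proof eventually_elim
      case (elim x)
      let ?c = "max 0 (min 1 (M + 1 - norm x))"
      have "(\<lambda>n. g x - H n x) \<longlonglongrightarrow> g x - max (- M) (min M (g x)) * ?c"
        unfolding H_def by (intro tendsto_intros lim elim)
      moreover have "max (- M) (min M (g x)) * ?c = g x"
        using g(1)[of x] M by (cases "norm x \<le> M") (auto simp: indicator_def)
      ultimately show ?case by simp
    qed
    then show "AE x in lborel. (\<lambda>n. g x - H n x) \<longlonglongrightarrow> 0"
      by (subst (asm) AE_completion_iff) auto
  qed (use p nn_integral_bounded_on_cball_finite in \<open>auto intro!: borel_measurable_times borel_measurable_indicator\<close>)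
  from tendsto_ennreal_0_obtain[OF this e'] obtain n
    where n: "(\<integral>\<^sup>+x. ennreal (\<bar>g x - H n x\<bar> powr p) \<partial>lborel) < ennreal e'" .
  have "(\<integral>\<^sup>+x. ennreal (\<bar>f x - H n x\<bar> powr p) \<partial>lborel)
      = (\<integral>\<^sup>+x. ennreal (\<bar>(f x - g x) - (H n x - g x)\<bar> powr p) \<partial>lborel)" by simp
  also have "\<dots> \<le> ennreal (2 powr p) * ((\<integral>\<^sup>+x. ennreal (\<bar>f x - g x\<bar> powr p) \<partial>lborel)
      + (\<integral>\<^sup>+x. ennreal (\<bar>H n x - g x\<bar> powr p) \<partial>lborel))"
    by (intro nn_integral_abs_diff_powr_le p) auto
  also have "\<dots> \<le> ennreal (2 powr p) * (ennreal e' + ennreal e')"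
    using g(2) n by (intro mult_left_mono add_mono) (auto simp: abs_minus_commute)
  also have "\<dots> = ennreal e"
    using e by (simp add: e'_def flip: ennreal_plus ennreal_mult)
  finally have "(\<integral>\<^sup>+x. ennreal (\<bar>f x - H n x\<bar> powr p) \<partial>lborel) \<le> ennreal e" .
  moreover have "\<bar>H n x\<bar> \<le> (M + 1) * indicator (cball 0 (M + 1)) x" for x
    using H_le[of n x] by (auto simp: indicator_def split: if_splits)
  ultimately show thesis using that contH by blast
qed

lemma Lp_translation_continuous_compact:
  fixes h :: "'a::euclidean_space \<Rightarrow> real"
  assumes p: "0 < p" and h: "continuous_on UNIV h" "\<And>x. \<bar>h x\<bar> \<le> M * indicator (cball 0 M) x"
    and y: "y \<longlonglongrightarrow> 0"
  shows "(\<lambda>n. \<integral>\<^sup>+x. ennreal (\<bar>h (x + y n) - h x\<bar> powr p) \<partial>lborel) \<longlonglongrightarrow> 0"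
proof -
  have [measurable]: "h \<in> borel_measurable borel"
    using h(1) by (intro borel_measurable_continuous_onI)
  obtain Y where Y: "\<And>n. norm (y n) \<le> Y"
    using convergent_imp_Bseq[of y] y unfolding Bseq_def convergent_def by blast
  have "0 \<le> Y" using Y[of 0] norm_ge_zero[of "y 0"] by linarith
  show ?thesis
  proof (rule nn_integral_powr_tendsto_0[where g = "\<lambda>x. (2 * \<bar>M\<bar>) * indicator (cball 0 (M + Y)) x"])
    show "AE x in lborel. \<bar>h (x + y n) - h x\<bar> \<le> (2 * \<bar>M\<bar>) * indicator (cball 0 (M + Y)) x" for n
    proof (intro AE_I2)
      fix x
      have "\<bar>h (x + y n)\<bar> \<le> \<bar>M\<bar> * indicator (cball 0 (M + Y)) x"
      proof (cases "norm (x + y n) \<le> M")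
        case True
        then have "norm x \<le> M + Y" using Y[of n] norm_diff_ineq[of x "y n"] by linarith
        then show ?thesis using h(2)[of "x + y n"] True by (simp add: indicator_def)
      next
        case False
        then show ?thesis using h(2)[of "x + y n"] by (simp add: indicator_def)
      qed
      moreover have "\<bar>h x\<bar> \<le> \<bar>M\<bar> * indicator (cball 0 (M + Y)) x"
        using h(2)[of x] \<open>0 \<le> Y\<close> by (cases "norm x \<le> M") (auto simp: indicator_def)
      ultimately show "\<bar>h (x + y n) - h x\<bar> \<le> (2 * \<bar>M\<bar>) * indicator (cball 0 (M + Y)) x" by linarith
    qed
    show "AE x in lborel. (\<lambda>n. h (x + y n) - h x) \<longlonglongrightarrow> 0"
    proof (intro AE_I2)
      fix x
      have "isCont h x" using h(1) continuous_on_eq_continuous_at by blast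
      moreover have "(\<lambda>n. x + y n) \<longlonglongrightarrow> x + 0" using y by (intro tendsto_intros)
      ultimately have "(\<lambda>n. h (x + y n)) \<longlonglongrightarrow> h x"
        using isCont_tendsto_compose[of x h] by simp
      then show "(\<lambda>n. h (x + y n) - h x) \<longlonglongrightarrow> 0" by (simp add: LIM_zero)
    qed
  qed (use p nn_integral_bounded_on_cball_finite in \<open>auto intro!: borel_measurable_times borel_measurable_indicator\<close>)
qed

text \<open>The usual three-part estimate: translate a continuous approximation \<open>h\<close> instead of \<open>f\<close>, the two
  errors being equal because Lebesgue measure is translation invariant.\<close>

lemma Lp_translation_continuous:
  fixes f :: "'a::euclidean_space \<Rightarrow> real"
  assumes p: "0 < p" and [measurable]: "f \<in> borel_measurable borel"
    and fin: "(\<integral>\<^sup>+x. ennreal (\<bar>f x\<bar> powr p) \<partial>lborel) < \<infinity>" and y: "y \<longlonglongrightarrow> 0"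
  shows "(\<lambda>n. \<integral>\<^sup>+x. ennreal (\<bar>f (x + y n) - f x\<bar> powr p) \<partial>lborel) \<longlonglongrightarrow> 0"
proof (rule order_tendstoI)
  fix e :: ennreal assume "0 < e"
  let ?c = "ennreal (2 powr p)"
  obtain r where r: "0 < r" "ennreal r < e"
  proof -
    obtain q where q: "0 < q" "q < e" using dense[OF \<open>0 < e\<close>] by blast
    then show thesis using that[of "enn2real q"]
      by (cases q) auto
  qed
  \<comment> \<open>Chosen so that the constants lost in splitting off the approximation are compensated.\<close>
  define d where "d = r / (2 powr p * (2 + 2 * 2 powr p))"
  have d: "0 < d" using r by (simp add: d_def add_pos_pos)
  have dr: "?c * (ennreal d + ?c * (ennreal d + ennreal d)) < e"
  proof -
    have "2 powr p * (d + 2 powr p * (d + d)) = d * (2 powr p * (1 + 2 * 2 powr p))"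
      by (simp add: algebra_simps)
    also have "\<dots> \<le> d * (2 powr p * (2 + 2 * 2 powr p))"
      using d by (intro mult_left_mono) auto
    also have "\<dots> = r"
    proof -
      have "2 powr p * (2 + 2 * 2 powr p) > 0" by (intro mult_pos_pos add_pos_pos) auto
      moreover have "r / c * c = r" if "0 < c" for c using that by simp
      ultimately show ?thesis unfolding d_def by blast
    qed
    finally have "ennreal (2 powr p * (d + 2 powr p * (d + d))) \<le> ennreal r" by (rule ennreal_leI)
    also note r(2)
    finally show ?thesis using d by (simp add: ennreal_mult flip: mult_2)
  qed
  obtain h M where h: "continuous_on UNIV h" "\<And>x. \<bar>h x\<bar> \<le> M * indicator (cball 0 M) x"
    and fh: "(\<integral>\<^sup>+x. ennreal (\<bar>f x - h x\<bar> powr p) \<partial>lborel) \<le> ennreal d"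
    using Lp_approx_continuous[OF p assms(2) fin d] by blast
  have [measurable]: "h \<in> borel_measurable borel"
    using h(1) by (intro borel_measurable_continuous_onI)
  have "(\<lambda>n. \<integral>\<^sup>+x. ennreal (\<bar>h (x + y n) - h x\<bar> powr p) \<partial>lborel) \<longlonglongrightarrow> 0"
    by (rule Lp_translation_continuous_compact[OF p h y])
  then have "\<forall>\<^sub>F n in sequentially. (\<integral>\<^sup>+x. ennreal (\<bar>h (x + y n) - h x\<bar> powr p) \<partial>lborel) < ennreal d"
    by (rule order_tendstoD) (use d in auto)
  then show "\<forall>\<^sub>F n in sequentially. (\<integral>\<^sup>+x. ennreal (\<bar>f (x + y n) - f x\<bar> powr p) \<partial>lborel) < e"
  proof eventually_elim
    case (elim n)
    let ?k = "\<lambda>x. f x - h x"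
    have "(\<integral>\<^sup>+x. ennreal (\<bar>f (x + y n) - f x\<bar> powr p) \<partial>lborel)
        = (\<integral>\<^sup>+x. ennreal (\<bar>?k (x + y n) - (?k x - (h (x + y n) - h x))\<bar> powr p) \<partial>lborel)"
      by (simp add: algebra_simps)
    also have "\<dots> \<le> ?c * ((\<integral>\<^sup>+x. ennreal (\<bar>?k (x + y n)\<bar> powr p) \<partial>lborel)
        + (\<integral>\<^sup>+x. ennreal (\<bar>?k x - (h (x + y n) - h x)\<bar> powr p) \<partial>lborel))"
      by (intro nn_integral_abs_diff_powr_le p) auto
    also have "\<dots> \<le> ?c * ((\<integral>\<^sup>+x. ennreal (\<bar>?k (x + y n)\<bar> powr p) \<partial>lborel)
        + ?c * ((\<integral>\<^sup>+x. ennreal (\<bar>?k x\<bar> powr p) \<partial>lborel)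
          + (\<integral>\<^sup>+x. ennreal (\<bar>h (x + y n) - h x\<bar> powr p) \<partial>lborel)))"
      by (intro mult_left_mono add_left_mono nn_integral_abs_diff_powr_le p) auto
    also have "(\<integral>\<^sup>+x. ennreal (\<bar>?k (x + y n)\<bar> powr p) \<partial>lborel) = (\<integral>\<^sup>+x. ennreal (\<bar>?k x\<bar> powr p) \<partial>lborel)"
      by (rule nn_integral_lborel_translate) auto
    also have "?c * ((\<integral>\<^sup>+x. ennreal (\<bar>?k x\<bar> powr p) \<partial>lborel)
        + ?c * ((\<integral>\<^sup>+x. ennreal (\<bar>?k x\<bar> powr p) \<partial>lborel)
          + (\<integral>\<^sup>+x. ennreal (\<bar>h (x + y n) - h x\<bar> powr p) \<partial>lborel)))
       \<le> ?c * (ennreal d + ?c * (ennreal d + ennreal d))"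
      using elim fh by (intro mult_left_mono add_mono) auto
    also have "\<dots> < e" by (rule dr)
    finally show ?case .
  qed
qed auto

section \<open>Mollification and the nonlocal energy\<close>

text \<open>Young's inequality says that the graph of \<open>t \<mapsto> t\<^sup>p\<close> lies above its tangent at \<open>a\<close>, the absolute
  value of the average of \<open>f\<close>; integrating the tangent inequality against \<open>\<rho>\<close> gives the claim, also
  when the right-hand side is infinite.\<close>

lemma Jensen_powr:
  fixes \<rho> f :: "'a \<Rightarrow> real"
  assumes p: "1 < p" and \<rho>: "\<And>x. 0 \<le> \<rho> x" "integrable M \<rho>" "(\<integral>x. \<rho> x \<partial>M) = 1"
    and f: "integrable M (\<lambda>x. \<rho> x * f x)" and [measurable]: "f \<in> borel_measurable M"
  shows "ennreal (\<bar>\<integral>x. \<rho> x * f x \<partial>M\<bar> powr p) \<le> (\<integral>\<^sup>+x. ennreal (\<rho> x) * ennreal (\<bar>f x\<bar> powr p) \<partial>M)"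
proof -
  note [measurable] = borel_measurable_integrable[OF \<rho>(2)]
  define a where "a = \<bar>\<integral>x. \<rho> x * f x \<partial>M\<bar>"
  have "0 \<le> a" by (simp add: a_def)
  \<comment> \<open>Young's inequality with exponents \<open>p\<close> and \<open>p / (p - 1)\<close>, rearranged to avoid subtraction.\<close>
  have young: "p * (a powr (p - 1) * t) \<le> t powr p + (p - 1) * a powr p" if "0 \<le> t" for t
  proof -
    define q where "q = p / (p - 1)"
    have q: "1 < q" "1 / p + 1 / q = 1" "(p - 1) * q = p" "p / q = p - 1"
      using p by (auto simp: q_def field_simps)
    have "t * a powr (p - 1) \<le> t powr p / p + (a powr (p - 1)) powr q / q"
      using p q that by (intro Youngs_inequality) auto
    then have "p * (t * a powr (p - 1)) \<le> p * (t powr p / p + a powr p / q)"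
      using p q(3) by (intro mult_left_mono) (auto simp: powr_powr)
    also have "\<dots> = t powr p + (p - 1) * a powr p"
    proof -
      have "p * (t powr p / p + a powr p / q) = t powr p + (p / q) * a powr p"
        using p by (simp add: distrib_left)
      then show ?thesis by (simp only: q(4))
    qed
    finally show ?thesis by (simp add: mult_ac)
  qed
  have one: "(\<integral>\<^sup>+x. ennreal (\<rho> x) \<partial>M) = 1"
    using \<rho> by (subst nn_integral_eq_integral) auto
  have "ennreal a \<le> (\<integral>\<^sup>+x. ennreal (\<rho> x * \<bar>f x\<bar>) \<partial>M)"
  proof -
    have "a \<le> (\<integral>x. \<bar>\<rho> x * f x\<bar> \<partial>M)"
      unfolding a_def using integral_norm_bound[of M "\<lambda>x. \<rho> x * f x"] by simp
    also have "ennreal \<dots> = (\<integral>\<^sup>+x. ennreal \<bar>\<rho> x * f x\<bar> \<partial>M)"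
      using f by (subst nn_integral_eq_integral) auto
    finally show ?thesis using \<rho>(1) by (simp add: abs_mult ennreal_leI)
  qed
  then have "ennreal (p * a powr (p - 1)) * ennreal a
      \<le> ennreal (p * a powr (p - 1)) * (\<integral>\<^sup>+x. ennreal (\<rho> x * \<bar>f x\<bar>) \<partial>M)"
    by (rule mult_left_mono) auto
  also have "\<dots> = (\<integral>\<^sup>+x. ennreal (p * a powr (p - 1)) * ennreal (\<rho> x * \<bar>f x\<bar>) \<partial>M)"
    by (subst nn_integral_cmult) auto
  also have "\<dots> \<le> (\<integral>\<^sup>+x. ennreal (\<rho> x) * ennreal (\<bar>f x\<bar> powr p) + ennreal (\<rho> x) * ennreal ((p - 1) * a powr p) \<partial>M)"
  proof (intro nn_integral_mono)
    fix x
    have "\<rho> x * (p * (a powr (p - 1) * \<bar>f x\<bar>)) \<le> \<rho> x * (\<bar>f x\<bar> powr p + (p - 1) * a powr p)"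
      using young[of "\<bar>f x\<bar>"] \<rho>(1) by (intro mult_left_mono) auto
    then have "ennreal (p * a powr (p - 1) * (\<rho> x * \<bar>f x\<bar>)) \<le> ennreal (\<rho> x * \<bar>f x\<bar> powr p + \<rho> x * ((p - 1) * a powr p))"
      by (intro ennreal_leI) (simp add: algebra_simps)
    then show "ennreal (p * a powr (p - 1)) * ennreal (\<rho> x * \<bar>f x\<bar>)
       \<le> ennreal (\<rho> x) * ennreal (\<bar>f x\<bar> powr p) + ennreal (\<rho> x) * ennreal ((p - 1) * a powr p)"
      using p \<rho>(1)[of x] by (simp add: ennreal_mult ennreal_plus)
  qed
  also have "\<dots> = (\<integral>\<^sup>+x. ennreal (\<rho> x) * ennreal (\<bar>f x\<bar> powr p) \<partial>M) + ennreal ((p - 1) * a powr p)"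
    by (simp add: nn_integral_add nn_integral_multc one)
  also have "ennreal (p * a powr (p - 1)) * ennreal a = ennreal (a powr p) + ennreal ((p - 1) * a powr p)"
  proof -
    have "a powr (p - 1) * a = a powr p"
      using \<open>0 \<le> a\<close> p by (cases "a = 0") (auto simp: powr_diff)
    then have "p * a powr (p - 1) * a = a powr p + (p - 1) * a powr p"
      by (simp add: algebra_simps)
    then show ?thesis using p \<open>0 \<le> a\<close>
      by (subst ennreal_mult[symmetric]) (auto simp flip: ennreal_plus)
  qed
  finally show ?thesis
    unfolding a_def[symmetric] by (subst (asm) (1 2) add.commute, subst (asm) ennreal_add_left_cancel_le) auto
qed

text \<open>The \<open>p\<close>-th power of the full norm of a fractional Sobolev-type space with kernel \<open>K\<close>. In the form of
  iterated integrals over \<open>lborel\<close> it depends only on the class of \<open>f\<close> modulo null sets, also when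
  \<open>f\<close> is merely Lebesgue measurable.\<close>

definition energy :: "'a::euclidean_space set \<Rightarrow> real \<Rightarrow> ('a \<Rightarrow> real) \<Rightarrow> ('a \<Rightarrow> real) \<Rightarrow> ennreal" where
  "energy \<Omega> p K f = (\<integral>\<^sup>+x\<in>\<Omega>. ennreal (\<bar>f x\<bar> powr p) \<partial>lborel)
     + (\<integral>\<^sup>+x\<in>\<Omega>. (\<integral>\<^sup>+y\<in>\<Omega>. ennreal (\<bar>f x - f y\<bar> powr p) * ennreal (K (x - y)) \<partial>lborel) \<partial>lborel)"

text \<open>The moment condition guarantees that compactly supported Lipschitz functions have finite energy.
  The kernel itself may be too singular at \<open>0\<close> to be integrable.\<close>

locale nonlocal_kernel =
  fixes p :: real and K :: "'a::euclidean_space \<Rightarrow> real"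
  assumes p: "1 < p"
    and kernel_measurable [measurable]: "K \<in> borel_measurable borel"
    and kernel_moment: "(\<integral>\<^sup>+z. ennreal (norm z powr p) * ennreal (K z) \<partial>lborel) < \<infinity>"
begin

text \<open>With \<open>h = x - y\<close> as a new variable, the energy becomes a weighted integral over \<open>h\<close> of \<open>L\<^sup>p\<close> norms in
  \<open>x\<close>, so that statements about \<open>L\<^sup>p\<close> can be applied for each \<open>h\<close> separately.\<close>

lemma energy_UNIV:
  assumes [measurable]: "f \<in> borel_measurable borel"
  shows "energy UNIV p K f = (\<integral>\<^sup>+x. ennreal (\<bar>f x\<bar> powr p) \<partial>lborel)
    + (\<integral>\<^sup>+h. ennreal (K h) * (\<integral>\<^sup>+x. ennreal (\<bar>f x - f (x - h)\<bar> powr p) \<partial>lborel) \<partial>lborel)"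
proof -
  have "(\<integral>\<^sup>+x. (\<integral>\<^sup>+y. ennreal (\<bar>f x - f y\<bar> powr p) * ennreal (K (x - y)) \<partial>lborel) \<partial>lborel)
    = (\<integral>\<^sup>+x. (\<integral>\<^sup>+h. ennreal (\<bar>f x - f (x - h)\<bar> powr p) * ennreal (K h) \<partial>lborel) \<partial>lborel)"
  proof (rule nn_integral_cong)
    fix x
    show "(\<integral>\<^sup>+y. ennreal (\<bar>f x - f y\<bar> powr p) * ennreal (K (x - y)) \<partial>lborel)
      = (\<integral>\<^sup>+h. ennreal (\<bar>f x - f (x - h)\<bar> powr p) * ennreal (K h) \<partial>lborel)"
      using nn_integral_lborel_reflect[of "\<lambda>h. ennreal (\<bar>f x - f (x - h)\<bar> powr p) * ennreal (K h)" x]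
      by simp
  qed
  also have "\<dots> = (\<integral>\<^sup>+h. (\<integral>\<^sup>+x. ennreal (\<bar>f x - f (x - h)\<bar> powr p) * ennreal (K h) \<partial>lborel) \<partial>lborel)"
    by (rule lborel_pair.Fubini'[symmetric]) measurable
  also have "\<dots> = (\<integral>\<^sup>+h. ennreal (K h) * (\<integral>\<^sup>+x. ennreal (\<bar>f x - f (x - h)\<bar> powr p) \<partial>lborel) \<partial>lborel)"
    by (intro nn_integral_cong) (subst nn_integral_multc, auto simp: mult.commute)
  finally show ?thesis
    by (simp add: energy_def)
qed

text \<open>Translation commutes with taking the difference \<open>W h x = f x - f (x - h)\<close>. For fixed \<open>h\<close> the
  function \<open>W h\<close> is in \<open>L\<^sup>p\<close>, so its translation differences tend to \<open>0\<close>; as functions of \<open>h\<close> they are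
  dominated by a multiple of \<open>\<integral> \<bar>W h x\<bar>\<^sup>p dx\<close>, which is integrable against \<open>K\<close> since \<open>f\<close> has finite energy.\<close>

lemma energy_translation_tendsto:
  assumes [measurable]: "f \<in> borel_measurable borel" and fin: "energy UNIV p K f < \<infinity>"
    and y: "y \<longlonglongrightarrow> 0"
  shows "(\<lambda>n. energy UNIV p K (\<lambda>x. f (x + y n) - f x)) \<longlonglongrightarrow> 0"
proof -
  let ?c = "ennreal (2 powr p)"
  have p0: "0 < p" using p by simp
  define W where "W h x = f x - f (x - h)" for h x
  define A where "A h = (\<integral>\<^sup>+x. ennreal (\<bar>W h x\<bar> powr p) \<partial>lborel)" for h
  have [measurable]: "W h \<in> borel_measurable borel" for h unfolding W_def by measurable
  have [measurable]: "A \<in> borel_measurable borel" unfolding A_def W_def by measurable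
  have Lp: "(\<integral>\<^sup>+x. ennreal (\<bar>f x\<bar> powr p) \<partial>lborel) < \<infinity>"
    and semi: "(\<integral>\<^sup>+h. ennreal (K h) * A h \<partial>lborel) < \<infinity>"
    using fin by (auto simp: energy_UNIV A_def W_def)
  \<comment> \<open>Finite for every \<open>h\<close>, not just for almost every one, because \<open>f\<close> itself is in \<open>L\<^sup>p\<close>.\<close>
  have A_fin: "A h < \<infinity>" for h
  proof -
    have "A h \<le> ?c * ((\<integral>\<^sup>+x. ennreal (\<bar>f x\<bar> powr p) \<partial>lborel) + (\<integral>\<^sup>+x. ennreal (\<bar>f (x - h)\<bar> powr p) \<partial>lborel))"
      unfolding A_def W_def by (intro nn_integral_abs_diff_powr_le p0) auto
    also have "(\<integral>\<^sup>+x. ennreal (\<bar>f (x - h)\<bar> powr p) \<partial>lborel) = (\<integral>\<^sup>+x. ennreal (\<bar>f x\<bar> powr p) \<partial>lborel)"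
      using nn_integral_lborel_translate[of "\<lambda>x. ennreal (\<bar>f x\<bar> powr p)" "- h"] by simp
    finally show ?thesis
      using Lp by (auto simp: ennreal_mult_less_top elim!: order_le_less_trans)
  qed
  define G where "G n h = (\<integral>\<^sup>+x. ennreal (\<bar>W h (x + y n) - W h x\<bar> powr p) \<partial>lborel)" for n h
  have [measurable]: "G n \<in> borel_measurable borel" for n unfolding G_def W_def by measurable
  have G_le: "G n h \<le> ?c * (A h + A h)" for n h
  proof -
    have "G n h \<le> ?c * ((\<integral>\<^sup>+x. ennreal (\<bar>W h (x + y n)\<bar> powr p) \<partial>lborel) + A h)"
      unfolding G_def A_def by (intro nn_integral_abs_diff_powr_le p0) auto
    also have "(\<integral>\<^sup>+x. ennreal (\<bar>W h (x + y n)\<bar> powr p) \<partial>lborel) = A h"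
      unfolding A_def by (rule nn_integral_lborel_translate) auto
    finally show ?thesis .
  qed
  have G_lim: "(\<lambda>n. G n h) \<longlonglongrightarrow> 0" for h
    unfolding G_def using A_fin[of h] y
    by (intro Lp_translation_continuous p0) (auto simp: A_def)
  have "(\<lambda>n. \<integral>\<^sup>+h. ennreal (K h) * G n h \<partial>lborel) \<longlonglongrightarrow> (\<integral>\<^sup>+h. 0 \<partial>(lborel :: 'a measure))"
  proof (rule nn_integral_dominated_convergence[where w = "\<lambda>h. ?c * (ennreal (K h) * A h + ennreal (K h) * A h)"])
    show "AE h in lborel. ennreal (K h) * G n h \<le> ?c * (ennreal (K h) * A h + ennreal (K h) * A h)" for n
    proof (intro AE_I2)
      fix h
      have "ennreal (K h) * G n h \<le> ennreal (K h) * (?c * (A h + A h))"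
        by (intro mult_left_mono G_le) auto
      also have "\<dots> = ?c * (ennreal (K h) * A h + ennreal (K h) * A h)"
        by (simp only: distrib_left mult.left_commute)
      finally show "ennreal (K h) * G n h \<le> ?c * (ennreal (K h) * A h + ennreal (K h) * A h)" .
    qed
    show "(\<integral>\<^sup>+h. ?c * (ennreal (K h) * A h + ennreal (K h) * A h) \<partial>lborel) < \<infinity>"
      using semi by (simp add: nn_integral_cmult nn_integral_add ennreal_mult_less_top)
    show "AE h in lborel. (\<lambda>n. ennreal (K h) * G n h) \<longlonglongrightarrow> 0"
    proof (intro AE_I2)
      fix h
      have "(\<lambda>n. ennreal (K h) * G n h) \<longlonglongrightarrow> ennreal (K h) * 0"
        by (intro ennreal_tendsto_cmult G_lim) auto
      then show "(\<lambda>n. ennreal (K h) * G n h) \<longlonglongrightarrow> 0" by simp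
    qed
  qed auto
  then have "(\<lambda>n. (\<integral>\<^sup>+x. ennreal (\<bar>f (x + y n) - f x\<bar> powr p) \<partial>lborel)
      + (\<integral>\<^sup>+h. ennreal (K h) * G n h \<partial>lborel)) \<longlonglongrightarrow> 0 + 0"
    by (intro tendsto_add Lp_translation_continuous[OF p0 _ Lp y]) auto
  moreover have "energy UNIV p K (\<lambda>x. f (x + y n) - f x)
     = (\<integral>\<^sup>+x. ennreal (\<bar>f (x + y n) - f x\<bar> powr p) \<partial>lborel) + (\<integral>\<^sup>+h. ennreal (K h) * G n h \<partial>lborel)" for n
    by (subst energy_UNIV) (auto simp: G_def W_def algebra_simps)
  ultimately show ?thesis by simp
qed

lemma energy_translation_small:
  assumes "f \<in> borel_measurable borel" and "energy UNIV p K f < \<infinity>" and e: "0 < e"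
  obtains d :: real where "0 < d" "\<And>z. norm z \<le> d \<Longrightarrow> energy UNIV p K (\<lambda>x. f (x - z) - f x) \<le> e"
proof -
  have "\<exists>d>0. \<forall>z. norm z \<le> d \<longrightarrow> energy UNIV p K (\<lambda>x. f (x - z) - f x) \<le> e"
  proof (rule ccontr)
    assume neg: "\<not> ?thesis"
    have "\<exists>z. norm z \<le> inverse (real (Suc n)) \<and> e < energy UNIV p K (\<lambda>x. f (x - z) - f x)" for n
    proof -
      have "0 < inverse (real (Suc n))" by simp
      with neg show ?thesis by (auto simp: not_le)
    qed
    then obtain z where z: "\<And>n. norm (z n) \<le> inverse (real (Suc n))"
      "\<And>n. e < energy UNIV p K (\<lambda>x. f (x - z n) - f x)" by metis
    have "z \<longlonglongrightarrow> 0"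
      by (rule Lim_null_comparison[OF _ LIMSEQ_inverse_real_of_nat]) (use z(1) in auto)
    then have "(\<lambda>n. - z n) \<longlonglongrightarrow> 0" using tendsto_minus[of z 0] by simp
    from energy_translation_tendsto[OF assms(1,2) this]
    have "(\<lambda>n. energy UNIV p K (\<lambda>x. f (x - z n) - f x)) \<longlonglongrightarrow> 0" by simp
    then obtain n where "energy UNIV p K (\<lambda>x. f (x - z n) - f x) < e"
      by (rule tendsto_ennreal_0_obtain[OF _ e])
    with z(2)[of n] show False by simp
  qed
  then show thesis using that by blast
qed

text \<open>Both \<open>w * \<rho> - w\<close> and its increments are \<open>\<rho>\<close>-averages of the corresponding quantities for the
  translation differences \<open>D z\<close>, so Jensen's inequality applies pointwise, and Tonelli's theorem
  moves the average outside.\<close>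

lemma energy_convolution_le:
  assumes [measurable]: "w \<in> borel_measurable borel" and w: "integrable lborel w"
    and \<rho>: "\<rho> \<in> test_functions r" "\<And>x. 0 \<le> \<rho> x" "integrable lborel \<rho>" "(\<integral>x. \<rho> x \<partial>lborel) = 1"
  shows "energy UNIV p K (\<lambda>x. convolution w \<rho> x - w x)
    \<le> (\<integral>\<^sup>+z. ennreal (\<rho> z) * energy UNIV p K (\<lambda>x. w (x - z) - w x) \<partial>lborel)"
proof -
  note [measurable] = test_functions_measurable[OF \<rho>(1)]
  define D where "D z x = w (x - z) - w x" for z x
  have [measurable]: "D z \<in> borel_measurable borel" for z unfolding D_def by measurable
  have [measurable]: "(\<lambda>z. D z x) \<in> borel_measurable borel" for x unfolding D_def by measurable
  have [measurable]: "case_prod D \<in> borel_measurable (borel \<Otimes>\<^sub>M borel)" unfolding D_def by measurable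
  have iw: "integrable lborel (\<lambda>z. \<rho> z * w (x - z))" for x
    by (rule integrable_convolution_commute[OF _ _ convolution_integrable[OF w \<rho>(1)]]) measurable
  have iD: "integrable lborel (\<lambda>z. \<rho> z * D z x)" for x
    unfolding D_def right_diff_distrib by (rule Bochner_Integration.integrable_diff[OF iw integrable_mult_left[OF \<rho>(3)]])
  have c: "convolution w \<rho> x - w x = (\<integral>z. \<rho> z * D z x \<partial>lborel)" for x
    unfolding D_def right_diff_distrib
    by (subst Bochner_Integration.integral_diff[OF iw integrable_mult_left[OF \<rho>(3)]])
      (simp add: convolution_commute \<rho>(4))
  have J: "ennreal (\<bar>convolution w \<rho> x - w x\<bar> powr p) \<le> (\<integral>\<^sup>+z. ennreal (\<rho> z) * ennreal (\<bar>D z x\<bar> powr p) \<partial>lborel)" for x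
    unfolding c by (rule Jensen_powr[OF p \<rho>(2-4) iD]) simp
  have J2: "ennreal (\<bar>(convolution w \<rho> x - w x) - (convolution w \<rho> y - w y)\<bar> powr p)
      \<le> (\<integral>\<^sup>+z. ennreal (\<rho> z) * ennreal (\<bar>D z x - D z y\<bar> powr p) \<partial>lborel)" for x y
  proof -
    have "(convolution w \<rho> x - w x) - (convolution w \<rho> y - w y) = (\<integral>z. \<rho> z * (D z x - D z y) \<partial>lborel)"
      unfolding c right_diff_distrib by (subst Bochner_Integration.integral_diff[OF iD iD]) (rule refl)
    moreover have "integrable lborel (\<lambda>z. \<rho> z * (D z x - D z y))"
      unfolding right_diff_distrib by (rule Bochner_Integration.integrable_diff[OF iD iD])
    ultimately show ?thesis by (simp only:) (rule Jensen_powr[OF p \<rho>(2-4)], simp_all)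
  qed
  have "(\<integral>\<^sup>+x. ennreal (\<bar>convolution w \<rho> x - w x\<bar> powr p) \<partial>lborel)
     \<le> (\<integral>\<^sup>+x. (\<integral>\<^sup>+z. ennreal (\<rho> z) * ennreal (\<bar>D z x\<bar> powr p) \<partial>lborel) \<partial>lborel)"
    by (intro nn_integral_mono J)
  also have "\<dots> = (\<integral>\<^sup>+z. (\<integral>\<^sup>+x. ennreal (\<rho> z) * ennreal (\<bar>D z x\<bar> powr p) \<partial>lborel) \<partial>lborel)"
    by (rule lborel_pair.Fubini'[symmetric]) (unfold D_def, measurable)
  also have "\<dots> = (\<integral>\<^sup>+z. ennreal (\<rho> z) * (\<integral>\<^sup>+x. ennreal (\<bar>D z x\<bar> powr p) \<partial>lborel) \<partial>lborel)"
    by (rule nn_integral_cong, rule nn_integral_cmult) measurable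
  finally have 1: "(\<integral>\<^sup>+x. ennreal (\<bar>convolution w \<rho> x - w x\<bar> powr p) \<partial>lborel)
     \<le> (\<integral>\<^sup>+z. ennreal (\<rho> z) * (\<integral>\<^sup>+x. ennreal (\<bar>D z x\<bar> powr p) \<partial>lborel) \<partial>lborel)" .
  have "(\<integral>\<^sup>+x. (\<integral>\<^sup>+y. ennreal (\<bar>(convolution w \<rho> x - w x) - (convolution w \<rho> y - w y)\<bar> powr p)
        * ennreal (K (x - y)) \<partial>lborel) \<partial>lborel)
      \<le> (\<integral>\<^sup>+x. (\<integral>\<^sup>+y. (\<integral>\<^sup>+z. ennreal (\<rho> z) * ennreal (\<bar>D z x - D z y\<bar> powr p) \<partial>lborel)
        * ennreal (K (x - y)) \<partial>lborel) \<partial>lborel)"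
    by (intro nn_integral_mono mult_right_mono J2 zero_le)
  also have "\<dots> = (\<integral>\<^sup>+x. (\<integral>\<^sup>+y. (\<integral>\<^sup>+z. ennreal (\<rho> z) * (ennreal (\<bar>D z x - D z y\<bar> powr p)
        * ennreal (K (x - y))) \<partial>lborel) \<partial>lborel) \<partial>lborel)"
  proof (rule nn_integral_cong, rule nn_integral_cong)
    fix x y
    show "(\<integral>\<^sup>+z. ennreal (\<rho> z) * ennreal (\<bar>D z x - D z y\<bar> powr p) \<partial>lborel) * ennreal (K (x - y))
      = (\<integral>\<^sup>+z. ennreal (\<rho> z) * (ennreal (\<bar>D z x - D z y\<bar> powr p) * ennreal (K (x - y))) \<partial>lborel)"
      by (subst nn_integral_multc[symmetric], measurable) (simp only: mult.assoc)
  qed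
  also have "\<dots> = (\<integral>\<^sup>+x. (\<integral>\<^sup>+z. (\<integral>\<^sup>+y. ennreal (\<rho> z) * (ennreal (\<bar>D z x - D z y\<bar> powr p)
        * ennreal (K (x - y))) \<partial>lborel) \<partial>lborel) \<partial>lborel)"
    by (rule nn_integral_cong, rule lborel_pair.Fubini'[symmetric]) (unfold D_def, measurable)
  also have "\<dots> = (\<integral>\<^sup>+z. (\<integral>\<^sup>+x. (\<integral>\<^sup>+y. ennreal (\<rho> z) * (ennreal (\<bar>D z x - D z y\<bar> powr p)
        * ennreal (K (x - y))) \<partial>lborel) \<partial>lborel) \<partial>lborel)"
    by (rule lborel_pair.Fubini'[symmetric]) (unfold D_def, measurable)
  also have "\<dots> = (\<integral>\<^sup>+z. ennreal (\<rho> z) * (\<integral>\<^sup>+x. (\<integral>\<^sup>+y. ennreal (\<bar>D z x - D z y\<bar> powr p)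
        * ennreal (K (x - y)) \<partial>lborel) \<partial>lborel) \<partial>lborel)"
  proof (rule nn_integral_cong)
    fix z
    have "(\<integral>\<^sup>+y. ennreal (\<rho> z) * (ennreal (\<bar>D z x - D z y\<bar> powr p) * ennreal (K (x - y))) \<partial>lborel)
      = ennreal (\<rho> z) * (\<integral>\<^sup>+y. ennreal (\<bar>D z x - D z y\<bar> powr p) * ennreal (K (x - y)) \<partial>lborel)" for x
      by (rule nn_integral_cmult) measurable
    then show "(\<integral>\<^sup>+x. (\<integral>\<^sup>+y. ennreal (\<rho> z) * (ennreal (\<bar>D z x - D z y\<bar> powr p)
        * ennreal (K (x - y))) \<partial>lborel) \<partial>lborel) = ennreal (\<rho> z) * (\<integral>\<^sup>+x. (\<integral>\<^sup>+y. ennreal (\<bar>D z x - D z y\<bar> powr p)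
        * ennreal (K (x - y)) \<partial>lborel) \<partial>lborel)"
      by (simp only:) (rule nn_integral_cmult, measurable)
  qed
  finally have 2: "(\<integral>\<^sup>+x. (\<integral>\<^sup>+y. ennreal (\<bar>(convolution w \<rho> x - w x) - (convolution w \<rho> y - w y)\<bar> powr p)
        * ennreal (K (x - y)) \<partial>lborel) \<partial>lborel)
     \<le> (\<integral>\<^sup>+z. ennreal (\<rho> z) * (\<integral>\<^sup>+x. (\<integral>\<^sup>+y. ennreal (\<bar>D z x - D z y\<bar> powr p)
        * ennreal (K (x - y)) \<partial>lborel) \<partial>lborel) \<partial>lborel)" .
  have [measurable]: "(\<lambda>z. \<integral>\<^sup>+x. ennreal (\<bar>D z x\<bar> powr p) \<partial>lborel) \<in> borel_measurable borel"
    "(\<lambda>z. \<integral>\<^sup>+x. (\<integral>\<^sup>+y. ennreal (\<bar>D z x - D z y\<bar> powr p) * ennreal (K (x - y)) \<partial>lborel) \<partial>lborel)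
       \<in> borel_measurable borel"
    unfolding D_def by measurable
  have "energy UNIV p K (\<lambda>x. convolution w \<rho> x - w x)
     \<le> (\<integral>\<^sup>+z. ennreal (\<rho> z) * (\<integral>\<^sup>+x. ennreal (\<bar>D z x\<bar> powr p) \<partial>lborel) \<partial>lborel)
      + (\<integral>\<^sup>+z. ennreal (\<rho> z) * (\<integral>\<^sup>+x. (\<integral>\<^sup>+y. ennreal (\<bar>D z x - D z y\<bar> powr p)
        * ennreal (K (x - y)) \<partial>lborel) \<partial>lborel) \<partial>lborel)"
    using add_mono[OF 1 2] by (simp add: energy_def)
  also have "\<dots> = (\<integral>\<^sup>+z. ennreal (\<rho> z) * energy UNIV p K (D z) \<partial>lborel)"
    unfolding energy_def by (subst nn_integral_add[symmetric]) (simp_all add: distrib_left)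
  finally show ?thesis by (simp add: D_def[abs_def])
qed

lemma energy_convolution_small:
  assumes w: "w \<in> borel_measurable borel" "integrable lborel w" "energy UNIV p K w < \<infinity>" and e: "0 < e"
  obtains d :: real where "0 < d" "\<And>\<rho>. \<rho> \<in> test_functions d \<Longrightarrow> (\<And>x. 0 \<le> \<rho> x) \<Longrightarrow> integrable lborel \<rho>
    \<Longrightarrow> (\<integral>x. \<rho> x \<partial>lborel) = 1 \<Longrightarrow> energy UNIV p K (\<lambda>x. convolution w \<rho> x - w x) \<le> e"
proof -
  obtain d where d: "0 < d" "\<And>z. norm z \<le> d \<Longrightarrow> energy UNIV p K (\<lambda>x. w (x - z) - w x) \<le> e"
    using energy_translation_small[OF w(1,3) e] by blast
  show thesis
  proof (rule that[OF d(1)])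
    fix \<rho> :: "'a \<Rightarrow> real"
    assume \<rho>: "\<rho> \<in> test_functions d" "\<And>x. 0 \<le> \<rho> x" "integrable lborel \<rho>" "(\<integral>x. \<rho> x \<partial>lborel) = 1"
    have "energy UNIV p K (\<lambda>x. convolution w \<rho> x - w x)
      \<le> (\<integral>\<^sup>+z. ennreal (\<rho> z) * energy UNIV p K (\<lambda>x. w (x - z) - w x) \<partial>lborel)"
      by (rule energy_convolution_le[OF w(1,2) \<rho>])
    also have "\<dots> \<le> (\<integral>\<^sup>+z. ennreal (\<rho> z) * e \<partial>lborel)"
    proof (intro nn_integral_mono)
      fix z
      show "ennreal (\<rho> z) * energy UNIV p K (\<lambda>x. w (x - z) - w x) \<le> ennreal (\<rho> z) * e"
      proof (cases "norm z \<le> d")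
        case True then show ?thesis by (intro mult_left_mono d(2)) auto
      next
        case False then show ?thesis using \<rho>(1) by (simp add: test_functions_def)
      qed
    qed
    also have "\<dots> = (\<integral>\<^sup>+z. ennreal (\<rho> z) \<partial>lborel) * e"
      using \<rho>(3) by (intro nn_integral_multc) auto
    also have "\<dots> = e"
      using \<rho> by (subst nn_integral_eq_integral) auto
    finally show "energy UNIV p K (\<lambda>x. convolution w \<rho> x - w x) \<le> e" .
  qed
qed

end

section \<open>Cutoffs, locally finite sums and the smooth approximation\<close>

text \<open>The increment of a product splits as
  \<open>\<phi> x (u x - u y) + u y (\<phi> x - \<phi> y)\<close> or as \<open>\<phi> y (u x - u y) + u x (\<phi> x - \<phi> y)\<close>. The increment of \<open>u\<close> is
  under control only when both points are in \<open>\<Omega>\<close>; if exactly one point lies outside, the splitting is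
  chosen so that the first term carries the factor \<open>\<phi>\<close> at that point and drops out.\<close>

lemma cutoff_difference_powr_le:
  fixes u \<phi> :: "'a::euclidean_space \<Rightarrow> real"
  assumes p: "0 < p" and u: "\<And>x. x \<notin> \<Omega> \<Longrightarrow> u x = 0"
    and L: "0 \<le> L" "\<And>x y. \<bar>\<phi> x - \<phi> y\<bar> \<le> L * norm (x - y)"
    and \<phi>: "\<And>x. \<bar>\<phi> x\<bar> \<le> 1" "\<And>x. x \<notin> \<Omega> \<Longrightarrow> \<phi> x = 0"
  shows "\<bar>\<phi> x * u x - \<phi> y * u y\<bar> powr p \<le> 2 powr p *
    (indicator \<Omega> x * indicator \<Omega> y * \<bar>u x - u y\<bar> powr p
     + L powr p * (\<bar>u x\<bar> powr p * norm (x - y) powr p)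
     + L powr p * (\<bar>u y\<bar> powr p * norm (x - y) powr p))"
proof -
  have cut: "\<bar>b * (\<phi> x - \<phi> y)\<bar> powr p \<le> L powr p * (\<bar>b\<bar> powr p * norm (x - y) powr p)" for b
  proof -
    have "\<bar>b * (\<phi> x - \<phi> y)\<bar> \<le> \<bar>b\<bar> * (L * norm (x - y))"
      using L(2)[of x y] by (auto simp: abs_mult intro!: mult_left_mono)
    then have "\<bar>b * (\<phi> x - \<phi> y)\<bar> powr p \<le> (\<bar>b\<bar> * (L * norm (x - y))) powr p"
      using p by (intro powr_mono2) auto
    then show ?thesis using L(1) by (simp add: powr_mult mult_ac)
  qed
  have small: "\<bar>\<phi> z * (u x - u y)\<bar> powr p \<le> \<bar>u x - u y\<bar> powr p" for z
    using p \<phi>(1)[of z] by (intro powr_mono2) (auto simp: abs_mult intro!: mult_left_le_one_le)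
  have nn: "0 \<le> L powr p * (\<bar>u x\<bar> powr p * norm (x - y) powr p)"
    "0 \<le> L powr p * (\<bar>u y\<bar> powr p * norm (x - y) powr p)" by auto
  show ?thesis
  proof (cases "x \<in> \<Omega> \<and> y \<notin> \<Omega>")
    case True
    then have "\<bar>\<phi> x * u x - \<phi> y * u y\<bar> = \<bar>\<phi> y * (u x - u y) - (- u x * (\<phi> x - \<phi> y))\<bar>" "\<phi> y = 0"
      using \<phi>(2) by (auto simp: algebra_simps)
    then have "\<bar>\<phi> x * u x - \<phi> y * u y\<bar> powr p \<le> 2 powr p * (0 + \<bar>u x * (\<phi> x - \<phi> y)\<bar> powr p)"
      using abs_diff_powr_le[OF p, of 0 "- u x * (\<phi> x - \<phi> y)"] by simp
    also have "\<dots> \<le> 2 powr p * (indicator \<Omega> x * indicator \<Omega> y * \<bar>u x - u y\<bar> powr p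
     + L powr p * (\<bar>u x\<bar> powr p * norm (x - y) powr p)
     + L powr p * (\<bar>u y\<bar> powr p * norm (x - y) powr p))"
    proof (rule mult_left_mono)
      have "0 \<le> indicator \<Omega> x * indicator \<Omega> y * \<bar>u x - u y\<bar> powr p" by simp
      then show "0 + \<bar>u x * (\<phi> x - \<phi> y)\<bar> powr p \<le> indicator \<Omega> x * indicator \<Omega> y * \<bar>u x - u y\<bar> powr p
       + L powr p * (\<bar>u x\<bar> powr p * norm (x - y) powr p)
       + L powr p * (\<bar>u y\<bar> powr p * norm (x - y) powr p)"
        using cut[of "u x"] nn by linarith
    qed simp
    finally show ?thesis .
  next
    case False
    then have *: "\<bar>\<phi> x * (u x - u y)\<bar> powr p \<le> indicator \<Omega> x * indicator \<Omega> y * \<bar>u x - u y\<bar> powr p"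
      using small[of x] \<phi>(2)[of x] by (auto simp: indicator_def)
    have "\<phi> x * u x - \<phi> y * u y = \<phi> x * (u x - u y) - (- u y * (\<phi> x - \<phi> y))"
      by (simp add: algebra_simps)
    then have "\<bar>\<phi> x * u x - \<phi> y * u y\<bar> powr p
      \<le> 2 powr p * (\<bar>\<phi> x * (u x - u y)\<bar> powr p + \<bar>u y * (\<phi> x - \<phi> y)\<bar> powr p)"
      using abs_diff_powr_le[OF p, of "\<phi> x * (u x - u y)" "- u y * (\<phi> x - \<phi> y)"] by simp
    also have "\<dots> \<le> 2 powr p * (indicator \<Omega> x * indicator \<Omega> y * \<bar>u x - u y\<bar> powr p
     + L powr p * (\<bar>u x\<bar> powr p * norm (x - y) powr p)
     + L powr p * (\<bar>u y\<bar> powr p * norm (x - y) powr p))"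
    proof (rule mult_left_mono)
      show "\<bar>\<phi> x * (u x - u y)\<bar> powr p + \<bar>u y * (\<phi> x - \<phi> y)\<bar> powr p
        \<le> indicator \<Omega> x * indicator \<Omega> y * \<bar>u x - u y\<bar> powr p
       + L powr p * (\<bar>u x\<bar> powr p * norm (x - y) powr p)
       + L powr p * (\<bar>u y\<bar> powr p * norm (x - y) powr p)"
        using cut[of "u y"] nn * by linarith
    qed simp
    finally show ?thesis .
  qed
qed

text \<open>On the support, \<open>\<bar>w\<bar> \<le> 1 + \<bar>w\<bar>\<^sup>p\<close>.\<close>

lemma compact_support_Lp_integrable:
  fixes w :: "'a::euclidean_space \<Rightarrow> real"
  assumes p: "1 \<le> p" and [measurable]: "w \<in> borel_measurable borel"
    and fin: "(\<integral>\<^sup>+x. ennreal (\<bar>w x\<bar> powr p) \<partial>lborel) < \<infinity>" and supp: "\<And>x. R < norm x \<Longrightarrow> w x = 0"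
  shows "integrable lborel w"
proof (rule integrableI_bounded)
  have "(\<integral>\<^sup>+x. ennreal (norm (w x)) \<partial>lborel)
      \<le> (\<integral>\<^sup>+x. indicator (cball 0 R) x + ennreal (\<bar>w x\<bar> powr p) \<partial>lborel)"
  proof (intro nn_integral_mono)
    fix x
    show "ennreal (norm (w x)) \<le> indicator (cball 0 R) x + ennreal (\<bar>w x\<bar> powr p)"
    proof (cases "1 \<le> \<bar>w x\<bar>")
      case True
      then have "\<bar>w x\<bar> powr 1 \<le> \<bar>w x\<bar> powr p" using p by (intro powr_mono) auto
      then have "ennreal (norm (w x)) \<le> ennreal (\<bar>w x\<bar> powr p)" using True by (simp add: ennreal_leI)
      then show ?thesis by (rule order_trans) (simp add: add_increasing)
    next
      case False
      then have "ennreal (norm (w x)) \<le> indicator (cball 0 R) x"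
        using supp[of x] by (cases "norm x \<le> R") (auto simp: indicator_def)
      then show ?thesis by (rule order_trans) (simp add: add_increasing2)
    qed
  qed
  also have "\<dots> = emeasure lborel (cball (0::'a) R) + (\<integral>\<^sup>+x. ennreal (\<bar>w x\<bar> powr p) \<partial>lborel)"
    by (subst nn_integral_add) (auto intro!: borel_measurable_indicator)
  also have "\<dots> < \<infinity>"
    using fin emeasure_lborel_cball_finite[of "0::'a" R] by simp
  finally show "(\<integral>\<^sup>+x. ennreal (norm (w x)) \<partial>lborel) < \<infinity>" .
qed auto

text \<open>The crude constants are independent of the number of summands, which is all that is needed to
  pass to infinite sums with prescribed weights.\<close>

lemma abs_sum_powr_le:
  fixes a :: "nat \<Rightarrow> real"
  assumes p: "0 < p"
  shows "\<bar>\<Sum>j<n. a j\<bar> powr p \<le> (\<Sum>j<n. (2 powr p) ^ Suc j * \<bar>a j\<bar> powr p)"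
proof (induction n arbitrary: a)
  case 0
  then show ?case using p by simp
next
  case (Suc n)
  have "\<bar>\<Sum>j<Suc n. a j\<bar> powr p = \<bar>a 0 - - (\<Sum>j<n. a (Suc j))\<bar> powr p"
    by (simp add: sum.lessThan_Suc_shift del: sum.lessThan_Suc)
  also have "\<dots> \<le> 2 powr p * (\<bar>a 0\<bar> powr p + \<bar>\<Sum>j<n. a (Suc j)\<bar> powr p)"
    using abs_diff_powr_le[OF p, of "a 0" "- (\<Sum>j<n. a (Suc j))"] by simp
  also have "\<dots> \<le> 2 powr p * (\<bar>a 0\<bar> powr p + (\<Sum>j<n. (2 powr p) ^ Suc j * \<bar>a (Suc j)\<bar> powr p))"
    by (intro mult_left_mono add_left_mono Suc.IH) auto
  also have "\<dots> = (\<Sum>j<Suc n. (2 powr p) ^ Suc j * \<bar>a j\<bar> powr p)"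
    unfolding sum.lessThan_Suc_shift by (simp add: distrib_left sum_distrib_left mult.assoc)
  finally show ?case .
qed

lemma ennreal_abs_powr_le_suminf:
  fixes a :: "nat \<Rightarrow> real"
  assumes "0 < p"
  shows "ennreal (\<bar>\<Sum>j<n. a j\<bar> powr p) \<le> (\<Sum>j. ennreal ((2 powr p) ^ Suc j) * ennreal (\<bar>a j\<bar> powr p))"
proof -
  have "ennreal (\<bar>\<Sum>j<n. a j\<bar> powr p) \<le> ennreal (\<Sum>j<n. (2 powr p) ^ Suc j * \<bar>a j\<bar> powr p)"
    by (intro ennreal_leI abs_sum_powr_le assms)
  also have "\<dots> = (\<Sum>j<n. ennreal ((2 powr p) ^ Suc j) * ennreal (\<bar>a j\<bar> powr p))"
    by (subst sum_ennreal[symmetric]) (auto simp: ennreal_mult simp del: power_Suc)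
  also have "\<dots> \<le> (\<Sum>j. ennreal ((2 powr p) ^ Suc j) * ennreal (\<bar>a j\<bar> powr p))"
    by (intro sum_le_suminf) auto
  finally show ?thesis .
qed

lemma energy_uminus: "energy \<Omega> p K (\<lambda>x. - f x) = energy \<Omega> p K f"
proof -
  have "\<bar>- f x - - f y\<bar> = \<bar>f x - f y\<bar>" for x y by simp
  then show ?thesis by (simp only: energy_def abs_minus_cancel)
qed

text \<open>The distance to the complement, with the constant \<open>1\<close> standing in for it on the whole space,
  where the distance to the empty set would be \<open>0\<close>.\<close>

lemma lipschitz_boundary_function:
  fixes \<Omega> :: "'a::euclidean_space set"
  assumes "open \<Omega>"
  obtains d :: "'a \<Rightarrow> real" where "\<And>x y. \<bar>d x - d y\<bar> \<le> norm (x - y)" "\<And>x. 0 \<le> d x"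
    "\<And>x. x \<in> \<Omega> \<Longrightarrow> 0 < d x" "\<And>x. x \<notin> \<Omega> \<Longrightarrow> d x = 0"
proof (cases "\<Omega> = UNIV")
  case True
  then show thesis by (intro that[of "\<lambda>x. 1"]) auto
next
  case False
  show thesis
  proof (rule that[of "\<lambda>x. infdist x (- \<Omega>)"])
    show "\<bar>infdist x (- \<Omega>) - infdist y (- \<Omega>)\<bar> \<le> norm (x - y)" for x y
      using infdist_triangle_abs[of x "- \<Omega>" y] by (simp add: dist_norm)
    show "0 < infdist x (- \<Omega>)" if "x \<in> \<Omega>" for x
      using that False assms infdist_pos_not_in_closed[of "- \<Omega>" x] by auto
  qed (auto simp: infdist_nonneg)
qed

text \<open>The \<open>n\<close>-th cutoff is supported where the function of the preceding lemma is at least \<open>1 / n\<close> and the norm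
  at most \<open>n\<close>. Every point of \<open>\<Omega>\<close> has a neighbourhood on which all late cutoffs are \<open>1\<close>, which makes the
  differences of successive cutoffs a locally finite partition of unity.\<close>

lemma lipschitz_exhaustion_cutoffs:
  fixes \<Omega> :: "'a::euclidean_space set"
  assumes "open \<Omega>"
  obtains \<eta> :: "nat \<Rightarrow> 'a \<Rightarrow> real" where
    "\<And>x. \<eta> 0 x = 0" "\<And>n x. 0 \<le> \<eta> n x" "\<And>n x. \<eta> n x \<le> 1"
    "\<And>n x y. \<bar>\<eta> n x - \<eta> n y\<bar> \<le> (real n + 1) * norm (x - y)"
    "\<And>n x. x \<notin> \<Omega> \<Longrightarrow> \<eta> n x = 0" "\<And>n x. real n < norm x \<Longrightarrow> \<eta> n x = 0"
    "\<And>x. x \<in> \<Omega> \<Longrightarrow> \<exists>r>0. \<exists>N. \<forall>n\<ge>N. \<forall>y. norm (y - x) \<le> r \<longrightarrow> \<eta> n y = 1"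
proof -
  obtain d :: "'a \<Rightarrow> real" where d: "\<And>x y. \<bar>d x - d y\<bar> \<le> norm (x - y)" "\<And>x. 0 \<le> d x"
    "\<And>x. x \<in> \<Omega> \<Longrightarrow> 0 < d x" "\<And>x. x \<notin> \<Omega> \<Longrightarrow> d x = 0"
    using lipschitz_boundary_function[OF assms] by blast
  define \<eta> where "\<eta> n x = max 0 (min 1 (min (real n * d x - 1) (real n - norm x)))" for n x
  show thesis
  proof (rule that[of \<eta>])
    show "\<bar>\<eta> n x - \<eta> n y\<bar> \<le> (real n + 1) * norm (x - y)" for n x y
    proof -
      have "\<bar>real n * d x - real n * d y\<bar> = real n * \<bar>d x - d y\<bar>"
        by (simp add: abs_mult flip: right_diff_distrib)
      also have "\<dots> \<le> real n * norm (x - y)" by (intro mult_left_mono d) auto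
      finally have "\<bar>real n * d x - real n * d y\<bar> \<le> (real n + 1) * norm (x - y)"
        by (simp add: distrib_right add_increasing2)
      moreover have "\<bar>norm x - norm y\<bar> \<le> (real n + 1) * norm (x - y)"
      proof -
        have "0 \<le> real n * norm (x - y)" by simp
        then show ?thesis using norm_triangle_ineq3[of x y] unfolding distrib_right by linarith
      qed
      ultimately show ?thesis unfolding \<eta>_def by linarith
    qed
    show "\<exists>r>0. \<exists>N. \<forall>n\<ge>N. \<forall>y. norm (y - x) \<le> r \<longrightarrow> \<eta> n y = 1" if "x \<in> \<Omega>" for x
    proof -
      have dx: "0 < d x" by (rule d(3)[OF that])
      obtain N where N: "4 / d x + (norm x + d x + 1) \<le> real N" using real_arch_simple by blast
      have "\<eta> n y = 1" if "N \<le> n" "norm (y - x) \<le> d x / 2" for n y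
      proof -
        have n: "4 / d x + (norm x + d x + 1) \<le> real n" using N that(1) by linarith
        have "0 < 4 / d x" using dx by simp
        with n have n1: "4 / d x \<le> real n" "norm x + d x + 1 \<le> real n"
          using norm_ge_zero[of x] dx by linarith+
        have "d x / 2 \<le> d y" using d(1)[of y x] that(2) by linarith
        then have "4 / d x * (d x / 2) \<le> real n * d y"
          using n1(1) dx by (intro mult_mono) auto
        then have "2 \<le> real n * d y" using dx by simp
        moreover have "norm y \<le> norm x + d x"
          using norm_triangle_ineq2[of y x] that(2) dx by linarith
        ultimately show ?thesis unfolding \<eta>_def using n1(2) by linarith
      qed
      then show ?thesis using dx by (intro exI[of _ "d x / 2"] conjI exI[of _ N]) auto
    qed
  qed (auto simp: \<eta>_def d)
qed

context nonlocal_kernel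
begin

text \<open>Integrating the pointwise bound for the increments: the term with \<open>u x - u y\<close> is the energy of \<open>u\<close>
  on \<open>\<Omega>\<close>, and in the two others the integration over the variable on which \<open>u\<close> does not depend
  produces the moment of the kernel.\<close>

lemma energy_cutoff_finite:
  assumes \<Omega> [measurable]: "\<Omega> \<in> sets borel" and [measurable]: "u \<in> borel_measurable borel" "\<phi> \<in> borel_measurable borel"
    and u: "\<And>x. x \<notin> \<Omega> \<Longrightarrow> u x = 0" "energy \<Omega> p K u < \<infinity>"
    and L: "0 \<le> L" "\<And>x y. \<bar>\<phi> x - \<phi> y\<bar> \<le> L * norm (x - y)"
    and \<phi>: "\<And>x. \<bar>\<phi> x\<bar> \<le> 1" "\<And>x. x \<notin> \<Omega> \<Longrightarrow> \<phi> x = 0"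
  shows "energy UNIV p K (\<lambda>x. \<phi> x * u x) < \<infinity>"
proof -
  have p0: "0 < p" using p by simp
  let ?c = "ennreal (2 powr p)" and ?l = "ennreal (L powr p)"
  define k where "k z = ennreal (norm z powr p) * ennreal (K z)" for z
  have [measurable]: "k \<in> borel_measurable borel" unfolding k_def by measurable
  define M where "M = (\<integral>\<^sup>+z. k z \<partial>lborel)"
  have M: "M < \<infinity>" using kernel_moment by (simp add: M_def k_def)
  define I where "I = (\<integral>\<^sup>+x. ennreal (\<bar>u x\<bar> powr p) \<partial>lborel)"
  define S where "S = (\<integral>\<^sup>+x\<in>\<Omega>. (\<integral>\<^sup>+y\<in>\<Omega>. ennreal (\<bar>u x - u y\<bar> powr p) * ennreal (K (x - y)) \<partial>lborel) \<partial>lborel)"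
  have "I = (\<integral>\<^sup>+x\<in>\<Omega>. ennreal (\<bar>u x\<bar> powr p) \<partial>lborel)"
    unfolding I_def using u(1) p0 by (intro nn_integral_cong) (auto simp: indicator_def)
  then have IS: "I < \<infinity>" "S < \<infinity>" using u(2) by (auto simp: energy_def S_def)
  have "(\<integral>\<^sup>+x. ennreal (\<bar>\<phi> x * u x\<bar> powr p) \<partial>lborel) \<le> I"
    unfolding I_def using \<phi>(1) p0
    by (intro nn_integral_mono ennreal_leI powr_mono2) (auto simp: abs_mult intro!: mult_left_le_one_le)
  then have 1: "(\<integral>\<^sup>+x. ennreal (\<bar>\<phi> x * u x\<bar> powr p) \<partial>lborel) < \<infinity>"
    using IS(1) by (rule order_le_less_trans)
  define T1 where "T1 x y = ennreal (\<bar>u x - u y\<bar> powr p) * ennreal (K (x - y)) * indicator \<Omega> y * indicator \<Omega> x" for x y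
  define T2 where "T2 x y = ennreal (\<bar>u x\<bar> powr p) * k (x - y)" for x y
  define T3 where "T3 x y = ennreal (\<bar>u y\<bar> powr p) * k (x - y)" for x y
  have [measurable]: "case_prod T1 \<in> borel_measurable (lborel \<Otimes>\<^sub>M lborel)"
     "case_prod T2 \<in> borel_measurable (lborel \<Otimes>\<^sub>M lborel)"
     "case_prod T3 \<in> borel_measurable (lborel \<Otimes>\<^sub>M lborel)"
    unfolding T1_def T2_def T3_def by measurable
  have "(\<integral>\<^sup>+x. (\<integral>\<^sup>+y. ennreal (\<bar>\<phi> x * u x - \<phi> y * u y\<bar> powr p) * ennreal (K (x - y)) \<partial>lborel) \<partial>lborel)
    \<le> (\<integral>\<^sup>+x. (\<integral>\<^sup>+y. ?c * (T1 x y + ?l * T2 x y + ?l * T3 x y) \<partial>lborel) \<partial>lborel)"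
  proof (rule nn_integral_mono, rule nn_integral_mono)
    fix x y
    have "ennreal (\<bar>\<phi> x * u x - \<phi> y * u y\<bar> powr p) \<le> ennreal (2 powr p *
    (indicator \<Omega> x * indicator \<Omega> y * \<bar>u x - u y\<bar> powr p
     + L powr p * (\<bar>u x\<bar> powr p * norm (x - y) powr p)
     + L powr p * (\<bar>u y\<bar> powr p * norm (x - y) powr p)))"
      by (intro ennreal_leI cutoff_difference_powr_le p0 u L \<phi>)
    also have "\<dots> = ?c * (indicator \<Omega> x * indicator \<Omega> y * ennreal (\<bar>u x - u y\<bar> powr p)
      + ?l * (ennreal (\<bar>u x\<bar> powr p) * ennreal (norm (x - y) powr p))
      + ?l * (ennreal (\<bar>u y\<bar> powr p) * ennreal (norm (x - y) powr p)))"
      by (simp add: ennreal_mult ennreal_plus ennreal_indicator)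
    finally have "ennreal (\<bar>\<phi> x * u x - \<phi> y * u y\<bar> powr p) * ennreal (K (x - y))
      \<le> \<dots> * ennreal (K (x - y))" by (rule mult_right_mono) auto
    then show "ennreal (\<bar>\<phi> x * u x - \<phi> y * u y\<bar> powr p) * ennreal (K (x - y))
      \<le> ?c * (T1 x y + ?l * T2 x y + ?l * T3 x y)"
      by (simp add: T1_def T2_def T3_def k_def distrib_left distrib_right mult_ac)
  qed
  also have "\<dots> = ?c * ((\<integral>\<^sup>+x. (\<integral>\<^sup>+y. T1 x y \<partial>lborel) \<partial>lborel)
      + ?l * (\<integral>\<^sup>+x. (\<integral>\<^sup>+y. T2 x y \<partial>lborel) \<partial>lborel) + ?l * (\<integral>\<^sup>+x. (\<integral>\<^sup>+y. T3 x y \<partial>lborel) \<partial>lborel))"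
    by (simp add: nn_integral_cmult nn_integral_add)
  also have "(\<integral>\<^sup>+x. (\<integral>\<^sup>+y. T1 x y \<partial>lborel) \<partial>lborel) = S"
    unfolding S_def T1_def by (rule nn_integral_cong, rule nn_integral_multc) measurable
  also have "(\<integral>\<^sup>+x. (\<integral>\<^sup>+y. T2 x y \<partial>lborel) \<partial>lborel) = I * M"
    unfolding T2_def I_def M_def
    by (simp add: nn_integral_cmult nn_integral_multc nn_integral_lborel_reflect)
  also have "(\<integral>\<^sup>+x. (\<integral>\<^sup>+y. T3 x y \<partial>lborel) \<partial>lborel) = (\<integral>\<^sup>+y. (\<integral>\<^sup>+x. T3 x y \<partial>lborel) \<partial>lborel)"
    by (rule lborel_pair.Fubini'[symmetric]) measurable
  also have "\<dots> = I * M"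
  proof -
    have "(\<integral>\<^sup>+x. k (x - y) \<partial>lborel) = M" for y
      using nn_integral_lborel_translate[of k "- y"] by (simp add: M_def)
    then show ?thesis
      unfolding T3_def I_def by (simp add: nn_integral_cmult nn_integral_multc)
  qed
  also have "?c * (S + ?l * (I * M) + ?l * (I * M)) < \<infinity>"
    using IS M by (simp add: ennreal_mult_less_top)
  finally show ?thesis using 1 by (simp add: energy_def)
qed

text \<open>Any two points see only finitely many summands, so the bound for finite sums holds for each
  increment, with the infinite series on the right; monotone convergence integrates it termwise.\<close>

lemma energy_locally_finite_sum_le:
  assumes \<Omega> [measurable]: "\<Omega> \<in> sets borel" and [measurable]: "\<And>j. a j \<in> borel_measurable borel"
    and f: "\<And>x. x \<in> \<Omega> \<Longrightarrow> \<exists>n. \<forall>m\<ge>n. f x = (\<Sum>j<m. a j x)"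
  shows "energy \<Omega> p K f \<le> (\<Sum>j. ennreal ((2 powr p) ^ Suc j) * energy UNIV p K (a j))"
proof -
  have p0: "0 < p" using p by simp
  let ?c = "\<lambda>j. ennreal ((2 powr p) ^ Suc j)"
  have pt: "ennreal (\<bar>f x\<bar> powr p) \<le> (\<Sum>j. ?c j * ennreal (\<bar>a j x\<bar> powr p))" if "x \<in> \<Omega>" for x
    using f[OF that] ennreal_abs_powr_le_suminf[OF p0] by (metis order_refl)
  have pt2: "ennreal (\<bar>f x - f y\<bar> powr p) \<le> (\<Sum>j. ?c j * ennreal (\<bar>a j x - a j y\<bar> powr p))"
    if xy: "x \<in> \<Omega>" "y \<in> \<Omega>" for x y
  proof -
    obtain n n' where "\<forall>m\<ge>n. f x = (\<Sum>j<m. a j x)" "\<forall>m\<ge>n'. f y = (\<Sum>j<m. a j y)"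
      using f[OF xy(1)] f[OF xy(2)] by blast
    then have "f x = (\<Sum>j<max n n'. a j x)" "f y = (\<Sum>j<max n n'. a j y)"
      using max.cobounded1 max.cobounded2 by blast+
    then have "f x - f y = (\<Sum>j<max n n'. a j x - a j y)"
      by (simp only: sum_subtractf)
    then show ?thesis using ennreal_abs_powr_le_suminf[OF p0] by simp
  qed
  have "(\<integral>\<^sup>+x\<in>\<Omega>. ennreal (\<bar>f x\<bar> powr p) \<partial>lborel) \<le> (\<integral>\<^sup>+x. (\<Sum>j. ?c j * ennreal (\<bar>a j x\<bar> powr p)) \<partial>lborel)"
    using pt by (intro nn_integral_mono) (auto simp: indicator_def)
  also have "\<dots> = (\<Sum>j. ?c j * (\<integral>\<^sup>+x. ennreal (\<bar>a j x\<bar> powr p) \<partial>lborel))"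
    by (subst nn_integral_suminf) (auto simp: nn_integral_cmult simp del: power_Suc)
  finally have 1: "(\<integral>\<^sup>+x\<in>\<Omega>. ennreal (\<bar>f x\<bar> powr p) \<partial>lborel) \<le> \<dots>" .
  have "(\<integral>\<^sup>+x\<in>\<Omega>. (\<integral>\<^sup>+y\<in>\<Omega>. ennreal (\<bar>f x - f y\<bar> powr p) * ennreal (K (x - y)) \<partial>lborel) \<partial>lborel)
    \<le> (\<integral>\<^sup>+x. (\<integral>\<^sup>+y. (\<Sum>j. ?c j * (ennreal (\<bar>a j x - a j y\<bar> powr p) * ennreal (K (x - y)))) \<partial>lborel) \<partial>lborel)"
  proof (rule nn_integral_mono)
    fix x
    have "(\<integral>\<^sup>+y\<in>\<Omega>. ennreal (\<bar>f x - f y\<bar> powr p) * ennreal (K (x - y)) \<partial>lborel)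
      \<le> (\<integral>\<^sup>+y. (\<Sum>j. ?c j * (ennreal (\<bar>a j x - a j y\<bar> powr p) * ennreal (K (x - y)))) \<partial>lborel)" if "x \<in> \<Omega>"
    proof (rule nn_integral_mono)
      fix y
      have "ennreal (\<bar>f x - f y\<bar> powr p) * ennreal (K (x - y))
        \<le> (\<Sum>j. ?c j * ennreal (\<bar>a j x - a j y\<bar> powr p)) * ennreal (K (x - y))" if "y \<in> \<Omega>"
        using pt2[OF \<open>x \<in> \<Omega>\<close> that] by (rule mult_right_mono) auto
      then show "ennreal (\<bar>f x - f y\<bar> powr p) * ennreal (K (x - y)) * indicator \<Omega> y
        \<le> (\<Sum>j. ?c j * (ennreal (\<bar>a j x - a j y\<bar> powr p) * ennreal (K (x - y))))"
        by (cases "y \<in> \<Omega>") (simp_all add: mult.assoc flip: ennreal_suminf_multc)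
    qed
    then show "(\<integral>\<^sup>+y\<in>\<Omega>. ennreal (\<bar>f x - f y\<bar> powr p) * ennreal (K (x - y)) \<partial>lborel) * indicator \<Omega> x
      \<le> (\<integral>\<^sup>+y. (\<Sum>j. ?c j * (ennreal (\<bar>a j x - a j y\<bar> powr p) * ennreal (K (x - y)))) \<partial>lborel)"
      by (cases "x \<in> \<Omega>") simp_all
  qed
  also have "\<dots> = (\<Sum>j. ?c j * (\<integral>\<^sup>+x. (\<integral>\<^sup>+y. ennreal (\<bar>a j x - a j y\<bar> powr p) * ennreal (K (x - y)) \<partial>lborel) \<partial>lborel))"
    by (simp add: nn_integral_suminf nn_integral_cmult del: power_Suc)
  finally have 2: "(\<integral>\<^sup>+x\<in>\<Omega>. (\<integral>\<^sup>+y\<in>\<Omega>. ennreal (\<bar>f x - f y\<bar> powr p) * ennreal (K (x - y)) \<partial>lborel) \<partial>lborel) \<le> \<dots>" .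
  show ?thesis
    using add_mono[OF 1 2] by (simp add: energy_def distrib_left suminf_add del: power_Suc)
qed

text \<open>The Meyers-Serrin construction. The pieces \<open>w j\<close> come from the partition of unity formed by
  successive differences of the cutoffs, and the mollification radius of the \<open>j\<close>-th piece is chosen so
  small that its error, multiplied by the factor it receives in the sum, is at most \<open>e / 2\<^bsup>j+1\<^esup>\<close>. The
  radius is also at most \<open>1 / (j + 1)\<close>, so that near a given point of \<open>\<Omega>\<close> all late mollified pieces
  vanish, just as the pieces themselves do.\<close>

lemma smooth_approximation:
  fixes e :: real
  assumes \<Omega>: "open \<Omega>" and [measurable]: "u \<in> borel_measurable borel"
    and u: "\<And>x. x \<notin> \<Omega> \<Longrightarrow> u x = 0" "energy \<Omega> p K u < \<infinity>" and e: "0 < e"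
  obtains v where "v \<in> C_infinity \<Omega>" "energy \<Omega> p K (\<lambda>x. u x - v x) \<le> ennreal e"
proof -
  have \<Omega>b: "\<Omega> \<in> sets borel" using \<Omega> by simp
  obtain \<eta> :: "nat \<Rightarrow> 'a \<Rightarrow> real" where \<eta>:
    "\<And>x. \<eta> 0 x = 0" "\<And>n x. 0 \<le> \<eta> n x" "\<And>n x. \<eta> n x \<le> 1"
    "\<And>n x y. \<bar>\<eta> n x - \<eta> n y\<bar> \<le> (real n + 1) * norm (x - y)"
    "\<And>n x. x \<notin> \<Omega> \<Longrightarrow> \<eta> n x = 0" "\<And>n x. real n < norm x \<Longrightarrow> \<eta> n x = 0"
    "\<And>x. x \<in> \<Omega> \<Longrightarrow> \<exists>r>0. \<exists>N. \<forall>n\<ge>N. \<forall>y. norm (y - x) \<le> r \<longrightarrow> \<eta> n y = 1"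
    using lipschitz_exhaustion_cutoffs[OF \<Omega>] by blast
  have [measurable]: "\<eta> n \<in> borel_measurable borel" for n
  proof (intro borel_measurable_continuous_onI)
    have "(real n + 1)-lipschitz_on UNIV (\<eta> n)"
      using \<eta>(4) by (intro lipschitz_onI) (auto simp: dist_norm)
    then show "continuous_on UNIV (\<eta> n)" by (rule lipschitz_on_continuous_on)
  qed
  define w where "w j x = (\<eta> (Suc j) x - \<eta> j x) * u x" for j x
  have wm [measurable]: "w j \<in> borel_measurable borel" for j unfolding w_def by measurable
  have w_energy: "energy UNIV p K (w j) < \<infinity>" for j
    unfolding w_def
  proof (rule energy_cutoff_finite[OF \<Omega>b _ _ u, where L = "(real (Suc j) + 1) + (real j + 1)"])
    show "\<bar>(\<eta> (Suc j) x - \<eta> j x) - (\<eta> (Suc j) y - \<eta> j y)\<bar> \<le> ((real (Suc j) + 1) + (real j + 1)) * norm (x - y)" for x y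
      using \<eta>(4)[of "Suc j" x y] \<eta>(4)[of j x y] unfolding distrib_right[of _ _ "norm (x - y)"] by linarith
    show "\<bar>\<eta> (Suc j) x - \<eta> j x\<bar> \<le> 1" for x
      using \<eta>(2,3)[of "Suc j" x] \<eta>(2,3)[of j x] by linarith
  qed (auto simp: \<eta>(5))
  have w_int: "integrable lborel (w j)" for j
  proof (rule compact_support_Lp_integrable[where p = p and R = "real (Suc j)"])
    show "(\<integral>\<^sup>+x. ennreal (\<bar>w j x\<bar> powr p) \<partial>lborel) < \<infinity>"
      using w_energy[of j] by (simp add: energy_def)
    show "w j x = 0" if "real (Suc j) < norm x" for x
      using \<eta>(6)[of "Suc j" x] \<eta>(6)[of j x] that by (simp add: w_def)
  qed (use p in auto)
  define c where "c j = (2 powr p) ^ Suc j" for j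
  have c: "0 < c j" for j unfolding c_def by (intro zero_less_power) simp
  define \<epsilon> where "\<epsilon> j = e * (1 / 2) ^ Suc j / c j" for j
  have \<epsilon>: "0 < ennreal (\<epsilon> j)" for j using e c[of j] by (simp add: \<epsilon>_def)
  have "\<exists>\<rho>. \<rho> \<in> test_functions (1 / (real j + 1)) \<and>
      energy UNIV p K (\<lambda>x. convolution (w j) \<rho> x - w j x) \<le> ennreal (\<epsilon> j)" for j
  proof -
    obtain d where d: "0 < d" "\<And>\<rho>. \<rho> \<in> test_functions d \<Longrightarrow> (\<And>x. 0 \<le> \<rho> x) \<Longrightarrow> integrable lborel \<rho>
      \<Longrightarrow> (\<integral>x. \<rho> x \<partial>lborel) = 1 \<Longrightarrow> energy UNIV p K (\<lambda>x. convolution (w j) \<rho> x - w j x) \<le> ennreal (\<epsilon> j)"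
      using energy_convolution_small[OF wm w_int w_energy \<epsilon>, of j j] by blast
    obtain \<rho> :: "'a \<Rightarrow> real" where \<rho>: "\<rho> \<in> C_infinity UNIV" "\<And>x. 0 \<le> \<rho> x"
      "\<And>x. min d (1 / (real j + 1)) \<le> norm x \<Longrightarrow> \<rho> x = 0" "integrable lborel \<rho>" "(\<integral>x. \<rho> x \<partial>lborel) = 1"
      using smooth_mollifier_exists[of "min d (1 / (real j + 1))"] d(1) by auto
    have "\<rho> \<in> test_functions d" "\<rho> \<in> test_functions (1 / (real j + 1))"
      using \<rho>(1,3) by (auto simp: test_functions_def)
    then show ?thesis using d(2)[OF _ \<rho>(2,4,5)] by blast
  qed
  then obtain \<rho> where \<rho>: "\<And>j. \<rho> j \<in> test_functions (1 / (real j + 1))"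
    and \<rho>_close: "\<And>j. energy UNIV p K (\<lambda>x. convolution (w j) (\<rho> j) x - w j x) \<le> ennreal (\<epsilon> j)"
    by metis
  define g where "g j = convolution (w j) (\<rho> j)" for j
  have g_smooth: "g j \<in> C_infinity UNIV" for j
    unfolding g_def by (rule convolution_smooth[OF w_int \<rho>])
  have [measurable]: "g j \<in> borel_measurable borel" for j
    using C_infinity_UNIV_D(3)[OF g_smooth] by (rule borel_measurable_continuous_onI)
  define v where "v x = (\<Sum>j. g j x)" for x
  have local: "\<exists>r>0. \<exists>N. \<forall>y\<in>ball x r. \<forall>m\<ge>N. u y = (\<Sum>j<m. w j y) \<and> v y = (\<Sum>j<m. g j y)" if x: "x \<in> \<Omega>" for x
  proof -
    obtain r N where r: "0 < r" "\<And>n y. N \<le> n \<Longrightarrow> norm (y - x) \<le> r \<Longrightarrow> \<eta> n y = 1"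
      using \<eta>(7)[OF x] by blast
    obtain N' where N': "2 / r \<le> real N'" using real_arch_simple by blast
    have w0: "w j y = 0" if "N \<le> j" "norm (y - x) \<le> r" for j y
      using r(2)[of j y] r(2)[of "Suc j" y] that by (simp add: w_def)
    \<comment> \<open>On a ball of half the radius, the mollification only reaches points where the piece vanishes.\<close>
    have g0: "g j y = 0" if "max N N' \<le> j" "norm (y - x) < r / 2" for j y
    proof -
      have "2 / r \<le> real j + 1" using N' that(1) by linarith
      then have j: "1 / (real j + 1) \<le> r / 2" using r(1) by (simp add: field_simps)
      have "w j t * \<rho> j (y - t) = 0" for t
      proof (cases "norm (t - x) \<le> r")
        case True
        then show ?thesis using w0[of j t] that(1) by simp
      next
        case False
        have "norm (t - x) \<le> norm (y - t) + norm (y - x)"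
          using norm_triangle_ineq4[of "y - x" "y - t"] by (simp add: algebra_simps)
        then have "1 / (real j + 1) < norm (y - t)" using False j that(2) by linarith
        then show ?thesis using \<rho>[of j] by (simp add: test_functions_def)
      qed
      then show ?thesis
        unfolding g_def convolution_def by (simp only: Bochner_Integration.integral_zero)
    qed
    have "u y = (\<Sum>j<m. w j y) \<and> v y = (\<Sum>j<m. g j y)" if "y \<in> ball x (r / 2)" "max N N' \<le> m" for y m
    proof
      have y: "norm (y - x) < r / 2" using that(1) by (simp add: dist_norm norm_minus_commute)
      have "(\<Sum>j<m. w j y) = (\<Sum>j<m. \<eta> (Suc j) y - \<eta> j y) * u y"
        by (simp add: w_def sum_distrib_right)
      also have "\<dots> = u y"
        using r(2)[of m y] y r(1) that(2) \<eta>(1)[of y] sum_lessThan_telescope[of "\<lambda>j. \<eta> j y" m]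
        by simp
      finally show "u y = (\<Sum>j<m. w j y)" by simp
      show "v y = (\<Sum>j<m. g j y)"
        unfolding v_def using g0 y that(2) by (intro suminf_finite) auto
    qed
    then show ?thesis using r(1) by (intro exI[of _ "r / 2"] conjI exI[of _ "max N N'"]) auto
  qed
  have "v \<in> C_infinity \<Omega>"
    unfolding C_infinity_def
  proof (intro CollectI allI Ck_on_local)
    fix k x assume "x \<in> \<Omega>"
    then obtain r N where r: "0 < r" "\<forall>y\<in>ball x r. \<forall>m\<ge>N. v y = (\<Sum>j<m. g j y)"
      using local by meson
    have "(\<lambda>y. \<Sum>j<N. g j y) \<in> C_infinity UNIV"
      by (intro C_infinity_UNIV_sum g_smooth)
    then have "Ck_on k UNIV (\<lambda>y. \<Sum>j<N. g j y)" by (simp add: C_infinity_def)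
    then have "Ck_on k (ball x r) (\<lambda>y. \<Sum>j<N. g j y)" by (rule Ck_on_subset) simp
    moreover have "(\<Sum>j<N. g j y) = v y" if "y \<in> ball x r" for y
      using bspec[OF r(2) that, THEN spec[of _ N]] by simp
    ultimately show "\<exists>U h. open U \<and> x \<in> U \<and> Ck_on k U h \<and> (\<forall>y\<in>U. h y = v y)"
      using r(1) by (intro exI[of _ "ball x r"] exI[of _ "\<lambda>y. \<Sum>j<N. g j y"]) auto
  qed
  moreover have "energy \<Omega> p K (\<lambda>x. u x - v x) \<le> ennreal e"
  proof -
    have "energy \<Omega> p K (\<lambda>x. u x - v x) = energy \<Omega> p K (\<lambda>x. v x - u x)"
      using energy_uminus[of \<Omega> p K "\<lambda>x. v x - u x"] by simp
    also have "\<dots> \<le> (\<Sum>j. ennreal (c j) * energy UNIV p K (\<lambda>x. g j x - w j x))"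
      unfolding c_def
    proof (rule energy_locally_finite_sum_le[OF \<Omega>b])
      fix x assume "x \<in> \<Omega>"
      then obtain r N where "0 < r" "\<forall>y\<in>ball x r. \<forall>m\<ge>N. u y = (\<Sum>j<m. w j y) \<and> v y = (\<Sum>j<m. g j y)"
        using local by meson
      then have *: "\<forall>m\<ge>N. u x = (\<Sum>j<m. w j x) \<and> v x = (\<Sum>j<m. g j x)" by simp
      have "v x - u x = (\<Sum>j<m. g j x - w j x)" if "N \<le> m" for m
        unfolding sum_subtractf using *[rule_format, OF that] by simp
      then show "\<exists>n. \<forall>m\<ge>n. v x - u x = (\<Sum>j<m. g j x - w j x)" by blast
    qed measurable
    also have "\<dots> \<le> (\<Sum>j. ennreal (c j) * ennreal (\<epsilon> j))"
      using \<rho>_close by (intro suminf_le mult_left_mono) (auto simp: g_def)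
    also have "\<dots> = (\<Sum>j. ennreal (e * (1 / 2) ^ Suc j))"
    proof -
      have "c j * \<epsilon> j = e * (1 / 2) ^ Suc j" for j using c[of j] by (simp add: \<epsilon>_def)
      moreover have "ennreal (c j) * ennreal (\<epsilon> j) = ennreal (c j * \<epsilon> j)" for j
        using c[of j] e by (intro ennreal_mult[symmetric]) (auto simp: \<epsilon>_def)
      ultimately show ?thesis by (simp only:)
    qed
    also have "\<dots> = ennreal e"
      using sums_mult[OF power_half_series, of e] e by (intro suminf_ennreal_eq) auto
    finally show ?thesis .
  qed
  ultimately show thesis by (rule that)
qed

end

section \<open>The logarithmic kernel\<close>

lemma dyadic_bracket:
  fixes t :: real
  assumes "0 < t" "t \<le> 1"
  obtains k :: nat where "(1 / 2) ^ Suc k < t" "t \<le> (1 / 2) ^ k"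
proof -
  have "\<exists>k. (1 / 2) ^ Suc k < t"
  proof -
    obtain n where "(1 / 2) ^ n < t" using real_arch_pow_inv[of t "1 / 2"] assms by auto
    then have "(1 / 2) ^ Suc n < t" using assms(1) by simp
    then show ?thesis by blast
  qed
  then obtain k where k: "(1 / 2) ^ Suc k < t" "\<forall>j<k. \<not> (1 / 2) ^ Suc j < t"
    using exists_least_iff[of "\<lambda>k. (1 / 2) ^ Suc k < t"] by blast
  have "t \<le> (1 / 2) ^ k"
  proof (cases k)
    case 0 then show ?thesis using assms by simp
  next
    case (Suc j) then show ?thesis using k(2) by (auto simp: not_less)
  qed
  with k(1) show thesis by (rule that)
qed

text \<open>With \<open>N\<close> the dimension, on the dyadic shell around radius \<open>2\<^bsup>-k\<^esup>\<close> the integrand is of order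
  \<open>2\<^bsup>-ka\<^esup> 2\<^bsup>kN\<^esup>\<close> while the volume is of order \<open>2\<^bsup>-kN\<^esup>\<close>, which leaves a geometric series with ratio
  \<open>2\<^bsup>-a\<^esup>\<close>.\<close>

lemma nn_integral_norm_powr_near_0:
  fixes a :: real
  assumes a: "0 < a"
  shows "(\<integral>\<^sup>+z. ennreal (norm (z :: 'a::euclidean_space) powr (a - real DIM('a)))
    * indicator (cball 0 1) z \<partial>lborel) < \<infinity>"
proof -
  let ?N = "DIM('a)"
  have [measurable]: "cball (0 :: 'a) r \<in> sets borel" for r by simp
  define q where "q = (1 / 2 :: real) powr a"
  have q: "0 < q" "q < 1" using a powr_less_mono2[of a "1 / 2" 1] by (auto simp: q_def)
  define c where "c k = q ^ k * (2 ^ Suc k) ^ ?N" for k :: nat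
  have c: "0 \<le> c k" for k using q by (simp add: c_def)
  have "ennreal (norm z powr (a - real ?N)) * indicator (cball 0 1) z
      \<le> (\<Sum>k. ennreal (c k) * indicator (cball 0 ((1 / 2) ^ k)) z)" for z :: 'a
  proof (cases "z \<noteq> 0 \<and> norm z \<le> 1")
    case True
    then obtain k where k: "(1 / 2) ^ Suc k < norm z" "norm z \<le> (1 / 2) ^ k"
      using dyadic_bracket[of "norm z"] by auto
    have "norm z powr a \<le> ((1 / 2) ^ k) powr a"
      using k a by (intro powr_mono2) auto
    also have "\<dots> = q ^ k"
      by (simp add: q_def powr_powr mult.commute flip: powr_realpow)
    finally have 1: "norm z powr a \<le> q ^ k" .
    have "1 / norm z \<le> 2 ^ Suc k"
      using k(1) True by (simp add: field_simps power_one_over)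
    then have "(1 / norm z) ^ ?N \<le> (2 ^ Suc k) ^ ?N"
      by (intro power_mono) auto
    then have "norm z powr (- real ?N) \<le> (2 ^ Suc k) ^ ?N"
      using True by (simp add: powr_minus powr_realpow power_one_over divide_simps)
    with 1 have "norm z powr a * norm z powr (- real ?N) \<le> c k"
      unfolding c_def using q by (intro mult_mono) auto
    then have "norm z powr (a - real ?N) \<le> c k"
      by (simp flip: powr_add)
    then have "ennreal (norm z powr (a - real ?N)) * indicator (cball 0 1) z
       \<le> ennreal (c k) * indicator (cball 0 ((1 / 2) ^ k)) z"
      using True k(2) by (simp add: ennreal_leI)
    also have "\<dots> \<le> (\<Sum>k. ennreal (c k) * indicator (cball 0 ((1 / 2) ^ k)) z)"
      using sum_le_suminf[of "\<lambda>k. ennreal (c k) * indicator (cball 0 ((1 / 2) ^ k)) z" "{k}"]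
      by (simp del: sum_mult_indicator)
    finally show ?thesis .
  qed auto
  then have "(\<integral>\<^sup>+z. ennreal (norm (z :: 'a) powr (a - real ?N)) * indicator (cball 0 1) z \<partial>lborel)
    \<le> (\<integral>\<^sup>+z. (\<Sum>k. ennreal (c k) * indicator (cball (0 :: 'a) ((1 / 2) ^ k)) z) \<partial>lborel)"
    by (intro nn_integral_mono)
  also have "\<dots> = (\<Sum>k. ennreal (c k) * emeasure lborel (cball (0 :: 'a) ((1 / 2) ^ k)))"
  proof -
    have "(\<lambda>z. ennreal (c k) * indicator (cball (0 :: 'a) ((1 / 2) ^ k)) z) \<in> borel_measurable lborel" for k
      by measurable
    then show ?thesis
      by (simp only: nn_integral_suminf nn_integral_cmult_indicator sets_lborel borel_closed closed_cball)
  qed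
  also have "\<dots> = (\<Sum>k. ennreal (2 ^ ?N * unit_ball_vol (real ?N) * q ^ k))"
  proof (rule suminf_cong)
    fix k
    have "c k * (unit_ball_vol (real ?N) * ((1 / 2) ^ k) ^ ?N)
      = ((2 ^ Suc k) ^ ?N * ((1 / 2) ^ k) ^ ?N) * unit_ball_vol (real ?N) * q ^ k"
      by (simp only: c_def mult_ac)
    also have "(2 ^ Suc k) ^ ?N * ((1 / 2) ^ k) ^ ?N = (2 :: real) ^ ?N"
      unfolding power_mult_distrib[symmetric] by (simp add: power_one_over)
    finally have "ennreal (c k * (unit_ball_vol (real ?N) * ((1 / 2) ^ k) ^ ?N))
      = ennreal (2 ^ ?N * unit_ball_vol (real ?N) * q ^ k)" by (rule arg_cong)
    moreover have "emeasure lborel (cball (0 :: 'a) ((1 / 2) ^ k))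
      = ennreal (unit_ball_vol (real ?N) * ((1 / 2) ^ k) ^ ?N)"
      by (rule emeasure_cball) simp
    ultimately show "ennreal (c k) * emeasure lborel (cball (0 :: 'a) ((1 / 2) ^ k))
      = ennreal (2 ^ ?N * unit_ball_vol (real ?N) * q ^ k)"
      using c[of k] by (simp only: ennreal_mult')
  qed
  also have "\<dots> < \<infinity>"
    using q by (subst suminf_ennreal2) (auto intro!: summable_mult summable_geometric)
  finally show ?thesis .
qed

lemma slog_kernel_measurable:
  "slog_kernel s p \<in> borel_measurable (borel :: 'a::euclidean_space measure)"
  unfolding slog_kernel_def[abs_def] by measurable

text \<open>The moment integrand has order \<open>\<bar>z\<bar>\<^bsup>p(1-s) - N\<^esup> (- ln \<bar>z\<bar>)\<close>. Giving up half of the positive power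
  \<open>p (1 - s)\<close> pays for the logarithm, and the other half, \<open>a\<close> below, keeps the integral finite.\<close>

lemma nonlocal_kernel_slog:
  assumes p: "1 < p" and s: "0 < s" "s < 1"
  shows "nonlocal_kernel p (slog_kernel s p :: 'a::euclidean_space \<Rightarrow> real)"
proof
  let ?N = "real DIM('a)" and ?C = "C_const DIM('a) s p"
  define a where "a = p * (1 - s) / 2"
  have a: "0 < a" using p s by (simp add: a_def)
  have [measurable]: "cball (0 :: 'a) r \<in> sets borel" for r by simp
  have C: "0 \<le> ?C" using C_const_nonneg[of s p "DIM('a)"] p s by simp
  have le: "norm z powr p * slog_kernel s p z \<le> ?C / a * (norm z powr (a - ?N) * indicator (cball 0 1) z)" for z :: 'a
  proof (cases "0 < norm z \<and> norm z < 1")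
    case True
    have "ln (1 / norm z) \<le> (1 / norm z) powr a / a"
      using True a by (intro ln_powr_bound) auto
    moreover have "ln (1 / norm z) = - ln (norm z)"
      using True by (simp add: ln_div)
    moreover have "(1 / norm z) powr a = norm z powr (- a)"
      by (simp add: powr_divide powr_minus_divide)
    ultimately have "- ln (norm z) \<le> norm z powr (- a) / a" by simp
    then have "max 0 (- ln (norm z)) \<le> norm z powr (- a) / a"
      using a by simp
    then have "norm z powr p * slog_kernel s p z
      \<le> norm z powr p * (?C * (norm z powr (- a) / a) / norm z powr (?N + s * p))"
      unfolding slog_kernel_def using C by (intro mult_left_mono divide_right_mono) auto
    also have "\<dots> = ?C / a * (norm z powr p * norm z powr (- a) * norm z powr (- (?N + s * p)))"
      unfolding powr_minus_divide[of _ "?N + s * p"] by (simp only: times_divide_eq_left times_divide_eq_right mult_1_right mult_ac)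
    also have "norm z powr p * norm z powr (- a) * norm z powr (- (?N + s * p)) = norm z powr (a - ?N)"
    proof -
      have "p + - a + - (?N + s * p) = a - ?N" by (simp add: a_def field_simps)
      then show ?thesis by (simp only: powr_add[symmetric])
    qed
    finally show ?thesis using True by simp
  next
    case False
    then have "slog_kernel s p z = 0 \<or> z = 0"
      by (auto simp: slog_kernel_def max_def not_less)
    then show ?thesis using a C by auto
  qed
  have "(\<integral>\<^sup>+z. ennreal (norm z powr p) * ennreal (slog_kernel s p z) \<partial>(lborel :: 'a measure))
     \<le> (\<integral>\<^sup>+z. ennreal (?C / a) * (ennreal (norm z powr (a - ?N)) * indicator (cball 0 1) z) \<partial>(lborel :: 'a measure))"
  proof (intro nn_integral_mono)
    fix z :: 'a
    have "ennreal (norm z powr p * slog_kernel s p z)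
      \<le> ennreal (?C / a * (norm z powr (a - ?N) * indicator (cball 0 1) z))"
      by (intro ennreal_leI le)
    also have "\<dots> = ennreal (?C / a) * (ennreal (norm z powr (a - ?N)) * indicator (cball 0 1) z)"
      using C a by (subst ennreal_mult) (simp_all add: ennreal_mult ennreal_indicator)
    finally show "ennreal (norm z powr p) * ennreal (slog_kernel s p z)
      \<le> ennreal (?C / a) * (ennreal (norm z powr (a - ?N)) * indicator (cball 0 1) z)"
      using slog_kernel_nonneg[of s p z] p s by (simp add: ennreal_mult)
  qed
  also have "\<dots> = ennreal (?C / a) * (\<integral>\<^sup>+z. ennreal (norm (z :: 'a) powr (a - ?N)) * indicator (cball 0 1) z \<partial>lborel)"
    by (rule nn_integral_cmult) measurable
  also have "\<dots> < \<infinity>"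
    using nn_integral_norm_powr_near_0[OF a, where 'a = 'a] by (simp add: ennreal_mult_less_top)
  finally show "(\<integral>\<^sup>+z. ennreal (norm z powr p) * ennreal (slog_kernel s p z) \<partial>(lborel :: 'a measure)) < \<infinity>" .
qed (use p slog_kernel_measurable in auto)

section \<open>From Lebesgue to Borel measurability, and the density theorem\<close>

lemma nn_integral_lebesgue_on:
  assumes "\<Omega> \<in> sets lebesgue"
  shows "(\<integral>\<^sup>+x. f x \<partial>lebesgue_on \<Omega>) = (\<integral>\<^sup>+x\<in>\<Omega>. f x \<partial>lborel)"
  using assms by (simp add: nn_integral_restrict_space nn_integral_completion)

lemma sigma_finite_lebesgue_on:
  fixes \<Omega> :: "'a::euclidean_space set"
  assumes "\<Omega> \<in> sets lebesgue"
  shows "sigma_finite_measure (lebesgue_on \<Omega>)"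
proof (rule sigma_finite_measure_restrict_space[OF _ assms])
  show "sigma_finite_measure (lebesgue :: 'a measure)"
  proof
    obtain A :: "'a set set" where A: "countable A" "A \<subseteq> sets lborel" "\<Union>A = space lborel"
      "\<forall>a\<in>A. emeasure lborel a \<noteq> \<infinity>"
      using lborel.sigma_finite_countable by blast
    have "A \<subseteq> sets lebesgue" using A(2) by auto
    moreover have "\<forall>a\<in>A. emeasure lebesgue a \<noteq> \<infinity>"
      using A(2,4) by auto
    ultimately show "\<exists>A. countable A \<and> A \<subseteq> sets lebesgue \<and> \<Union> A = space (lebesgue :: 'a measure)
        \<and> (\<forall>a\<in>A. emeasure lebesgue a \<noteq> \<infinity>)"
      using A by (intro exI[of _ A]) auto
  qed
qed

text \<open>Tonelli's theorem turns the integral over the product into an iterated one. In the iterated form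
  Lebesgue measure may be replaced by its restriction to Borel sets, since both give the same
  nonnegative integrals.\<close>

lemma energy_slog_eq:
  fixes \<Omega> :: "'a::euclidean_space set"
  assumes \<Omega>: "\<Omega> \<in> sets lebesgue" and sp: "0 < s" "s < 1" "0 < p"
    and [measurable]: "f \<in> borel_measurable (lebesgue_on \<Omega>)"
  shows "Lp_norm_pow \<Omega> p f + slog_seminorm_pow \<Omega> s p f = energy \<Omega> p (slog_kernel s p) f"
proof -
  let ?L = "lebesgue_on \<Omega>"
  interpret L: sigma_finite_measure ?L by (rule sigma_finite_lebesgue_on[OF \<Omega>])
  have [measurable]: "(\<lambda>x. x) \<in> ?L \<rightarrow>\<^sub>M borel"
    by (intro measurable_restrict_space1 measurable_completion) simp
  note [measurable] = slog_kernel_measurable[of s p, where 'a = 'a]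
  have "slog_seminorm_pow \<Omega> s p f
      = (\<integral>\<^sup>+x. (\<integral>\<^sup>+y. ennreal (\<bar>f x - f y\<bar> powr p * slog_kernel s p (x - y)) \<partial>?L) \<partial>?L)"
    unfolding slog_seminorm_pow_def by (subst L.nn_integral_fst[symmetric]) (auto simp: case_prod_beta)
  also have "\<dots> = (\<integral>\<^sup>+x\<in>\<Omega>. (\<integral>\<^sup>+y\<in>\<Omega>. ennreal (\<bar>f x - f y\<bar> powr p) * ennreal (slog_kernel s p (x - y)) \<partial>lborel) \<partial>lborel)"
    by (simp add: nn_integral_lebesgue_on[OF \<Omega>] ennreal_mult slog_kernel_nonneg[OF sp])
  finally show ?thesis
    by (simp add: energy_def Lp_norm_pow_def nn_integral_lebesgue_on[OF \<Omega>])
qed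

lemma energy_cong_AE:
  assumes "AE x in lborel. x \<in> \<Omega> \<longrightarrow> f x = g x"
  shows "energy \<Omega> p K f = energy \<Omega> p K g"
proof -
  have "(\<integral>\<^sup>+y\<in>\<Omega>. ennreal (\<bar>a - f y\<bar> powr p) * ennreal (K (x - y)) \<partial>lborel)
    = (\<integral>\<^sup>+y\<in>\<Omega>. ennreal (\<bar>a - g y\<bar> powr p) * ennreal (K (x - y)) \<partial>lborel)" for a x
    using assms by (intro nn_integral_cong_AE) (auto simp: indicator_def)
  moreover have "(\<integral>\<^sup>+x\<in>\<Omega>. F (f x) x \<partial>lborel) = (\<integral>\<^sup>+x\<in>\<Omega>. F (g x) x \<partial>lborel)" for F :: "real \<Rightarrow> _ \<Rightarrow> ennreal"
    using assms by (intro nn_integral_cong_AE) (auto simp: indicator_def)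
  note this[of "\<lambda>a x. ennreal (\<bar>a\<bar> powr p)"]
    this[of "\<lambda>a x. \<integral>\<^sup>+y\<in>\<Omega>. ennreal (\<bar>a - g y\<bar> powr p) * ennreal (K (x - y)) \<partial>lborel"]
  ultimately show ?thesis by (simp add: energy_def)
qed

lemma borel_representative:
  fixes \<Omega> :: "'a::euclidean_space set"
  assumes \<Omega>: "\<Omega> \<in> sets borel" and u: "u \<in> borel_measurable (lebesgue_on \<Omega>)"
  obtains u' :: "'a \<Rightarrow> real" where "u' \<in> borel_measurable borel" "\<And>x. x \<notin> \<Omega> \<Longrightarrow> u' x = 0"
    "AE x in lborel. x \<in> \<Omega> \<longrightarrow> u x = u' x"
proof -
  have \<Omega>': "\<Omega> \<in> sets lebesgue" using \<Omega> by simp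
  have "(\<lambda>x. if x \<in> \<Omega> then u x else 0) \<in> borel_measurable lebesgue"
    using u \<Omega>' by (simp add: borel_measurable_if)
  then obtain g where g: "g \<in> borel_measurable lborel" "AE x in lborel. (if x \<in> \<Omega> then u x else 0) = g x"
    using completion_ex_borel_measurable_real by blast
  show thesis
  proof (rule that[of "\<lambda>x. indicator \<Omega> x * g x"])
    show "(\<lambda>x. indicator \<Omega> x * g x) \<in> borel_measurable borel"
      using g(1) \<Omega> by (intro borel_measurable_times borel_measurable_indicator) auto
    show "AE x in lborel. x \<in> \<Omega> \<longrightarrow> u x = indicator \<Omega> x * g x"
      using g(2) by eventually_elim auto
  qed auto
qed

theorem theorem4p5:
  fixes \<Omega> :: "'a::euclidean_space set" and s p :: real
  assumes "open \<Omega>" and "1 < p" and "0 < s" and "s < 1"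
  shows "\<forall>u \<in> W_slog \<Omega> s p. \<forall>\<epsilon>>0. \<exists>v \<in> C_infinity \<Omega> \<inter> W_slog \<Omega> s p.
           W_slog_norm \<Omega> s p (\<lambda>x. u x - v x) < \<epsilon>"
proof (intro ballI allI impI)
  fix u and \<epsilon> :: real
  assume u: "u \<in> W_slog \<Omega> s p" and \<epsilon>: "0 < \<epsilon>"
  let ?K = "slog_kernel s p :: 'a \<Rightarrow> real"
  interpret nonlocal_kernel p ?K
    using assms by (intro nonlocal_kernel_slog)
  have sp: "0 < s" "s < 1" "0 < p" using assms by auto
  have \<Omega>: "\<Omega> \<in> sets borel" "\<Omega> \<in> sets lebesgue" using assms(1) by auto
  have um: "u \<in> borel_measurable (lebesgue_on \<Omega>)"
    using u by (simp add: W_slog_def Lp_space_def)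
  obtain u' where u': "u' \<in> borel_measurable borel" "\<And>x. x \<notin> \<Omega> \<Longrightarrow> u' x = 0"
    and eq: "AE x in lborel. x \<in> \<Omega> \<longrightarrow> u x = u' x"
    using borel_representative[OF \<Omega>(1) um] by blast
  have "energy \<Omega> p ?K u' = energy \<Omega> p ?K u"
    using energy_cong_AE[OF eq] by simp
  also have "\<dots> = Lp_norm_pow \<Omega> p u + slog_seminorm_pow \<Omega> s p u"
    using energy_slog_eq[OF \<Omega>(2) sp um] by simp
  also have "\<dots> < \<infinity>"
    using u by (simp add: W_slog_def Lp_space_def)
  finally have fin: "energy \<Omega> p ?K u' < \<infinity>" .
  \<comment> \<open>Half of \<open>\<epsilon>\<close>, since the approximation gives only a weak inequality.\<close>
  define \<delta> where "\<delta> = (\<epsilon> / 2) powr p"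
  have "0 < \<delta>" using \<epsilon> by (simp add: \<delta>_def)
  then obtain v where v: "v \<in> C_infinity \<Omega>" "energy \<Omega> p ?K (\<lambda>x. u' x - v x) \<le> ennreal \<delta>"
    using smooth_approximation[OF assms(1) u' fin] by blast
  have "Ck_on 0 \<Omega> v" using v(1) unfolding C_infinity_def by blast
  then have "continuous_on \<Omega> v" by simp
  then have vm: "v \<in> borel_measurable (lebesgue_on \<Omega>)"
    using \<Omega>(2) by (intro continuous_imp_measurable_on_sets_lebesgue)
  have dm: "(\<lambda>x. u x - v x) \<in> borel_measurable (lebesgue_on \<Omega>)"
    using um vm by simp
  have "Lp_norm_pow \<Omega> p (\<lambda>x. u x - v x) + slog_seminorm_pow \<Omega> s p (\<lambda>x. u x - v x)
     = energy \<Omega> p ?K (\<lambda>x. u x - v x)"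
    by (rule energy_slog_eq[OF \<Omega>(2) sp dm])
  also have "\<dots> = energy \<Omega> p ?K (\<lambda>x. u' x - v x)"
    by (rule energy_cong_AE) (use eq in eventually_elim, auto)
  also note v(2)
  finally have close: "Lp_norm_pow \<Omega> p (\<lambda>x. u x - v x) + slog_seminorm_pow \<Omega> s p (\<lambda>x. u x - v x) \<le> ennreal \<delta>" .
  then have lt: "Lp_norm_pow \<Omega> p (\<lambda>x. u x - v x) < \<infinity>" "slog_seminorm_pow \<Omega> s p (\<lambda>x. u x - v x) < \<infinity>"
    by (auto intro: order_le_less_trans[OF order_trans[OF _ close]] simp: add_increasing add_increasing2)
  then have "(\<lambda>x. u x - v x) \<in> W_slog \<Omega> s p"
    using dm by (simp add: W_slog_def Lp_space_def)
  from W_slog_diff[OF sp u this] have vW: "v \<in> W_slog \<Omega> s p" by simp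
  have "enn2real (Lp_norm_pow \<Omega> p (\<lambda>x. u x - v x)) + enn2real (slog_seminorm_pow \<Omega> s p (\<lambda>x. u x - v x)) \<le> \<delta>"
    using close \<open>0 < \<delta>\<close> lt by (subst enn2real_plus[symmetric]) (auto intro: enn2real_leI)
  then have "W_slog_norm \<Omega> s p (\<lambda>x. u x - v x) \<le> \<delta> powr (1 / p)"
    unfolding W_slog_norm_def using sp by (intro powr_mono2) auto
  also have "\<dots> = \<epsilon> / 2" using \<epsilon> sp by (simp add: \<delta>_def powr_powr)
  also have "\<dots> < \<epsilon>" using \<epsilon> by simp
  finally show "\<exists>v \<in> C_infinity \<Omega> \<inter> W_slog \<Omega> s p. W_slog_norm \<Omega> s p (\<lambda>x. u x - v x) < \<epsilon>"
    using v(1) vW by blast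
qed

end
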